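(* The maximum vertex- and edge-weighted induced path problem is solvable in polynomial time in chordal graphs: there is a polynomial-time algorithm which, given a chordal graph $G=(V,E)$ and rational weights $c\in\mathbb{Q}^V$, $d\in\mathbb{Q}^E$, finds an induced path $W\subseteq V$ of $G$ maximizing $\sum_{v\in W}c_v+\sum_{e\in E(W)}d_e$.
   Context: All graphs are finite and simple. A graph is chordal if it has no induced cycle of length at least 4. An induced path of $G$ is a (nonempty) vertex set $W\subseteq V$ whose elements can be ordered as $v_1,\dots,v_p$ so that the edges of $G[W]$ are exactly $v_iv_{i+1}$, $1\le i\le p-1$ (a single vertex is an induced path). $E(W)$ is the set of edges of $G$ with both endpoints in $W$. Weights may be of arbitrary sign. *)

theory Defs
  imports Complex_Main "HOL-Library.Log_Nat" "HOL-Computational_Algebra.Polynomial"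
begin

section \<open>Graphs\<close>

definition simple_graph :: "'a set \<Rightarrow> 'a set set \<Rightarrow> bool" where
  "simple_graph V E \<longleftrightarrow> finite V \<and> (\<forall>e\<in>E. e \<subseteq> V \<and> card e = 2)"

definition induced_edges :: "'a set set \<Rightarrow> 'a set \<Rightarrow> 'a set set" where
  "induced_edges E W = {e \<in> E. e \<subseteq> W}"

definition induced_path :: "'a set \<Rightarrow> 'a set set \<Rightarrow> 'a set \<Rightarrow> bool" where
  "induced_path V E W \<longleftrightarrow> W \<subseteq> V \<and>
     (\<exists>vs. vs \<noteq> [] \<and> distinct vs \<and> set vs = W \<and>
        induced_edges E W = {{vs ! i, vs ! Suc i} | i. Suc i < length vs})"

definition induced_cycle :: "'a set \<Rightarrow> 'a set set \<Rightarrow> 'a set \<Rightarrow> bool" where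
  "induced_cycle V E W \<longleftrightarrow> W \<subseteq> V \<and>
     (\<exists>vs. 3 \<le> length vs \<and> distinct vs \<and> set vs = W \<and>
        induced_edges E W = {{vs ! i, vs ! (Suc i mod length vs)} | i. i < length vs})"

definition chordal :: "'a set \<Rightarrow> 'a set set \<Rightarrow> bool" where
  "chordal V E \<longleftrightarrow> \<not> (\<exists>W. induced_cycle V E W \<and> card W \<ge> 4)"

definition path_weight :: "'a set set \<Rightarrow> ('a \<Rightarrow> rat) \<Rightarrow> ('a set \<Rightarrow> rat) \<Rightarrow> 'a set \<Rightarrow> rat" where
  "path_weight E c d W = (\<Sum>v\<in>W. c v) + (\<Sum>e\<in>induced_edges E W. d e)"

definition max_weight_induced_path ::
  "'a set \<Rightarrow> 'a set set \<Rightarrow> ('a \<Rightarrow> rat) \<Rightarrow> ('a set \<Rightarrow> rat) \<Rightarrow> 'a set \<Rightarrow> bool" where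
  "max_weight_induced_path V E c d W \<longleftrightarrow> induced_path V E W \<and>
     (\<forall>W'. induced_path V E W' \<longrightarrow> path_weight E c d W' \<le> path_weight E c d W)"


section \<open>Random access machines with logarithmic cost\<close>

text \<open>
  The model of computation is the random access machine of Cook and Reckhow with the
  logarithmic cost criterion, which is polynomially equivalent to the Turing machine.
  Programs are structured (while programs instead of jumps).  The memory is
  divided into banks, of which every single program uses only finitely many; each cell holds an
  integer.  Every operation is charged the binary lengths of the values and addresses involved, so
  that a computation of cost \<open>t\<close> cannot build or address numbers with more than \<open>O(t)\<close> bits.
\<close>

type_synonym memory = "nat \<Rightarrow> int \<Rightarrow> int"

datatype binop = Add | Sub | Mul | Div | Lt

datatype aexp = Const int | Read nat aexp | Op binop aexp aexp

datatype com =
    Skip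
  | Write nat aexp aexp  \<comment> \<open>bank, address, value\<close>
  | Seq com com
  | If aexp com com
  | While aexp com

text \<open>Binary digits of the absolute value, and one more bit for the sign.\<close>

definition len :: "int \<Rightarrow> nat" where
  "len x = Suc (floorlog 2 (nat \<bar>x\<bar>))"

fun apply_op :: "binop \<Rightarrow> int \<Rightarrow> int \<Rightarrow> int" where
  "apply_op Add x y = x + y"
| "apply_op Sub x y = x - y"
| "apply_op Mul x y = x * y"
| "apply_op Div x y = x div y"
| "apply_op Lt x y = (if x < y then 1 else 0)"

fun aval :: "aexp \<Rightarrow> memory \<Rightarrow> int" where
  "aval (Const k) s = k"
| "aval (Read b e) s = s b (aval e s)"
| "aval (Op f e1 e2) s = apply_op f (aval e1 s) (aval e2 s)"

fun acost :: "aexp \<Rightarrow> memory \<Rightarrow> nat" where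
  "acost (Const k) s = len k"
| "acost (Read b e) s = acost e s + len (aval e s) + len (aval (Read b e) s)"
| "acost (Op f e1 e2) s = acost e1 s + acost e2 s
     + len (aval e1 s) + len (aval e2 s) + len (aval (Op f e1 e2) s)"

text \<open>
  \<open>exec c s t s'\<close>: started in memory \<open>s\<close>, the program \<open>c\<close> halts with memory \<open>s'\<close> and total
  cost \<open>t\<close>.  Guards are true iff they are nonzero.
\<close>

inductive exec :: "com \<Rightarrow> memory \<Rightarrow> nat \<Rightarrow> memory \<Rightarrow> bool" where
  Skip: "exec Skip s 1 s"
| Write: "exec (Write b e1 e2) s
    (acost e1 s + acost e2 s + len (aval e1 s) + len (aval e2 s))
    (s(b := (s b)(aval e1 s := aval e2 s)))"
| Seq: "exec c1 s t1 s1 \<Longrightarrow> exec c2 s1 t2 s2 \<Longrightarrow> exec (Seq c1 c2) s (t1 + t2) s2"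
| IfTrue: "aval e s \<noteq> 0 \<Longrightarrow> exec c1 s t s' \<Longrightarrow>
    exec (If e c1 c2) s (acost e s + len (aval e s) + t) s'"
| IfFalse: "aval e s = 0 \<Longrightarrow> exec c2 s t s' \<Longrightarrow>
    exec (If e c1 c2) s (acost e s + len (aval e s) + t) s'"
| WhileFalse: "aval e s = 0 \<Longrightarrow> exec (While e c) s (acost e s + len (aval e s)) s"
| WhileTrue: "aval e s \<noteq> 0 \<Longrightarrow> exec c s t1 s1 \<Longrightarrow> exec (While e c) s1 t2 s2 \<Longrightarrow>
    exec (While e c) s (acost e s + len (aval e s) + t1 + t2) s2"

lemma exec_deterministic:
  "exec c s t s' \<Longrightarrow> exec c s u s'' \<Longrightarrow> t = u \<and> s' = s''"
proof (induction arbitrary: u s'' rule: exec.induct)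
  case (Seq c1 s t1 s1 c2 t2 s2)
  from Seq.prems show ?case by cases (use Seq.IH in blast)
next
  case (WhileTrue e s c t1 s1 t2 s2)
  from WhileTrue.prems show ?case by cases (use WhileTrue.IH WhileTrue.hyps in blast)+
qed (erule exec.cases; auto)+

text \<open>The input is written to bank 0, starting at address 0; all other cells are 0.\<close>

definition initial_memory :: "int list \<Rightarrow> memory" where
  "initial_memory xs = (\<lambda>b i. if b = 0 \<and> 0 \<le> i \<and> i < int (length xs) then xs ! nat i else 0)"

text \<open>The output is a set of vertices, given by its incidence vector in bank 1.\<close>

definition output_set :: "nat \<Rightarrow> memory \<Rightarrow> nat set" where
  "output_set n s = {v. v < n \<and> s 1 (int v) \<noteq> 0}"


section \<open>Encoding of instances\<close>

definition encode_rat :: "rat \<Rightarrow> int list" where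
  "encode_rat r = [fst (quotient_of r), snd (quotient_of r)]"

text \<open>
  A weighted graph with vertices \<open>0, \<dots>, n - 1\<close> is given by \<open>n\<close>, the list of vertex weights, and
  the adjacency matrix, whose entries consist of the adjacency bit and the edge weight
  (0 if there is no edge).
\<close>

definition encode_instance ::
  "nat \<Rightarrow> nat set set \<Rightarrow> (nat \<Rightarrow> rat) \<Rightarrow> (nat set \<Rightarrow> rat) \<Rightarrow> int list" where
  "encode_instance n E c d =
     int n # concat (map (\<lambda>v. encode_rat (c v)) [0..<n])
     @ concat (map (\<lambda>u. concat (map (\<lambda>v.
         if {u, v} \<in> E then 1 # encode_rat (d {u, v}) else 0 # encode_rat 0) [0..<n])) [0..<n])"

definition input_size :: "int list \<Rightarrow> nat" where
  "input_size xs = (\<Sum>x\<leftarrow>xs. len x)"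

end

theory Submission imports Defs begin

text \<open>In a chordal graph, a walk \<open>v\<^sub>1, \<dots>, v\<^sub>p\<close> with \<open>v\<^sub>i \<noteq> v\<^sub>i\<^sub>+\<^sub>2\<close> and \<open>v\<^sub>i\<close>, \<open>v\<^sub>i\<^sub>+\<^sub>2\<close> not adjacent
  for all \<open>i\<close> is already an induced path: a repetition or chord \<open>v\<^sub>i v\<^sub>j\<close> with \<open>j - i\<close> minimal would close
  an induced cycle of length at least 4. Being an induced path is therefore a condition on three
  consecutive vertices, and a maximum weight path is found by dynamic programming over the pairs of
  consecutive vertices and the number of vertices left. The rational weights are scaled to integers
  by the product of all denominators, whose length is polynomial in the input size.\<close>

text \<open>A dynamic program cannot remember which vertices a walk has visited, and chordality is
  what makes up for that. Optimality is split into two halves: the table values bound all walks of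
  at most \<open>n\<close> vertices from above, which covers every induced path since its vertices
  are distinct, and the recorded successors exhibit a walk that attains the bound. The first vertex
  has no predecessor, so an isolated virtual one is added; it absorbs the special cases of the first
  turn and of one-vertex paths.

  Under logarithmic cost, the time of a structured program is at most a polynomial in the largest
  number of rounds of a loop, times the largest length of a cell. The complexity proof thus reduces
  to bounding the values that are written. A product of denominators is taken instead of a least
  common multiple because it needs no gcd, and \<open>n * (n + 1)\<close> factors still have
  polynomial length.\<close>

section \<open>Induced paths in chordal graphs\<close>

text \<open>A walk with the predecessor \<open>u\<close> of its first vertex; \<open>ok u v w\<close> says that the walk may
  turn from the edge \<open>u v\<close> into the edge \<open>v w\<close>.\<close>

fun walk :: "('a \<Rightarrow> 'a \<Rightarrow> 'a \<Rightarrow> bool) \<Rightarrow> 'a \<Rightarrow> 'a list \<Rightarrow> bool" where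
  "walk ok u (v # w # xs) \<longleftrightarrow> ok u v w \<and> walk ok v (w # xs)"
| "walk ok u xs \<longleftrightarrow> True"

fun walk_sum :: "('a \<Rightarrow> 'a \<Rightarrow> 'b::comm_monoid_add) \<Rightarrow> 'a \<Rightarrow> 'a list \<Rightarrow> 'b" where
  "walk_sum wt u [] = 0"
| "walk_sum wt u (v # xs) = wt u v + walk_sum wt v xs"

text \<open>\<open>walk\<close> recurses at the front, whereas following recorded successors appends
  at the end; \<open>last (p # ys)\<close> covers the empty prefix, whose last vertex is the
  predecessor \<open>p\<close>.\<close>

lemma walk_snoc:
  "walk ok p (ys @ [v, w]) \<longleftrightarrow> walk ok p (ys @ [v]) \<and> ok (last (p # ys)) v w"
proof (induction ys arbitrary: p)
  case (Cons y ys)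
  then show ?case by (cases ys) auto
qed simp

lemma walk_sum_snoc:
  "walk_sum wt p (ys @ [v]) = walk_sum wt p ys + wt (last (p # ys)) v"
  by (induction ys arbitrary: p) (auto simp: add.assoc)

lemma walk_iff_nth:
  "walk ok p xs \<longleftrightarrow> (\<forall>i. Suc i < length xs \<longrightarrow> ok ((p # xs) ! i) (xs ! i) (xs ! Suc i))"
proof (induction ok p xs rule: walk.induct)
  case (1 ok u v w xs)
  have split: "(\<forall>i. P i) \<longleftrightarrow> P 0 \<and> (\<forall>i. P (Suc i))" for P :: "nat \<Rightarrow> bool"
    by (metis not0_implies_Suc)
  have "(\<forall>i. Suc i < length (v # w # xs) \<longrightarrow>
        ok ((u # v # w # xs) ! i) ((v # w # xs) ! i) ((v # w # xs) ! Suc i)) \<longleftrightarrow>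
      ok u v w \<and> (\<forall>i. Suc i < length (w # xs) \<longrightarrow>
        ok ((v # w # xs) ! i) ((w # xs) ! i) ((w # xs) ! Suc i))"
    by (subst split) auto
  then show ?case using 1 by simp
qed auto

lemma walk_sum_nth: "walk_sum wt p xs = (\<Sum>i<length xs. wt ((p # xs) ! i) (xs ! i))"
  by (induction xs arbitrary: p) (auto simp: sum.lessThan_Suc_shift simp del: sum.lessThan_Suc)

text \<open>For \<open>k > 0\<close> this is the largest weight of a walk of at most
  \<open>k\<close> vertices that starts in \<open>v\<close> with predecessor \<open>u\<close>; the
  inserted 0 is the option to stop at \<open>v\<close>. The value 0 at \<open>k = 0\<close> never
  beats that option, so no walk with too many vertices is counted.\<close>

fun best_walk :: "('a \<Rightarrow> 'a \<Rightarrow> 'a \<Rightarrow> bool) \<Rightarrow> ('a \<Rightarrow> 'a \<Rightarrow> int) \<Rightarrow> 'a set \<Rightarrow> nat \<Rightarrow> 'a \<Rightarrow> 'a \<Rightarrow> int" where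
  "best_walk ok wt V 0 u v = 0"
| "best_walk ok wt V (Suc k) u v =
     wt u v + Max (insert 0 (best_walk ok wt V k v ` {w \<in> V. ok u v w}))"

text \<open>One half of optimality; that the value is attained follows from the successors recorded
  with the table.\<close>

lemma walk_sum_le_best_walk:
  assumes "finite V"
  shows "walk ok u (v # xs) \<Longrightarrow> set (v # xs) \<subseteq> V \<Longrightarrow> length (v # xs) \<le> k \<Longrightarrow>
    walk_sum wt u (v # xs) \<le> best_walk ok wt V k u v"
proof (induction xs arbitrary: u v k)
  case Nil
  then obtain k' where "k = Suc k'" by (cases k) auto
  then show ?case using assms by simp
next
  case (Cons w xs)
  then obtain k' where k: "k = Suc k'" by (cases k) auto
  have "walk_sum wt v (w # xs) \<le> best_walk ok wt V k' v w"
    using Cons k by auto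
  also have "\<dots> \<le> Max (insert 0 (best_walk ok wt V k' v ` {w \<in> V. ok u v w}))"
    using assms Cons.prems by (intro Max_ge) auto
  finally show ?case using k by simp
qed

lemma abs_best_walk_le:
  assumes "finite V" and wt: "\<And>u v. v \<in> V \<Longrightarrow> u \<in> U \<Longrightarrow> \<bar>wt u v\<bar> \<le> X" and "V \<subseteq> U"
  shows "u \<in> U \<Longrightarrow> v \<in> V \<Longrightarrow> \<bar>best_walk ok wt V k u v\<bar> \<le> int k * X"
proof (induction k arbitrary: u v)
  case (Suc k)
  let ?S = "insert 0 (best_walk ok wt V k v ` {w \<in> V. ok u v w})"
  have X: "0 \<le> X" using wt[OF Suc.prems(2,1)] by simp
  have "Max ?S \<in> ?S" using assms(1) by (intro Max_in) auto
  then have "\<bar>Max ?S\<bar> \<le> int k * X" using Suc X \<open>V \<subseteq> U\<close> by auto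
  then show ?case using wt[OF Suc.prems(2,1)] by (simp add: algebra_simps)
qed simp

section \<open>Turning walks and induced paths in chordal graphs\<close>

lemma doubleton_as_nth:
  assumes "e \<subseteq> set us" "card e = 2"
  obtains j k where "j < k" "k < length us" "e = {us ! j, us ! k}"
proof -
  obtain x y where xy: "e = {x, y}" "x \<noteq> y" using assms(2) by (meson card_2_iff)
  then obtain a b where ab: "a < length us" "us ! a = x" "b < length us" "us ! b = y"
    using assms(1) by (metis in_set_conv_nth insert_subset)
  then have "a \<noteq> b" using xy by blast
  then consider "a < b" | "b < a" by linarith
  then show thesis
    using that[of a b] that[of b a] xy ab by cases (simp_all add: insert_commute)
qed

text \<open>Strong induction on the distance \<open>m\<close>. A repetition at distance
  \<open>m\<close> is a chord at distance \<open>m - 1\<close>, because the last edge then ends in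
  \<open>vs ! i\<close>. A chord at distance \<open>m \<ge> 3\<close> closes a cycle on
  \<open>m + 1\<close> vertices, which is induced because all shorter distances are free of
  repetitions and chords.\<close>

lemma walk_induced_in_chordal:
  assumes E: "simple_graph V E" and chordal: "chordal V E" and sub: "set vs \<subseteq> V"
    and edge: "\<And>i. Suc i < length vs \<Longrightarrow> {vs ! i, vs ! Suc i} \<in> E"
    and skip: "\<And>i. Suc (Suc i) < length vs \<Longrightarrow>
      vs ! i \<noteq> vs ! Suc (Suc i) \<and> {vs ! i, vs ! Suc (Suc i)} \<notin> E"
  shows "i + m < length vs \<Longrightarrow> 2 \<le> m \<Longrightarrow> vs ! i \<noteq> vs ! (i + m) \<and> {vs ! i, vs ! (i + m)} \<notin> E"
proof (induction m arbitrary: i rule: less_induct)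
  case (less m)
  have neq_edge: "x \<noteq> y" if "{x, y} \<in> E" for x y
    using that E unfolding simple_graph_def by fastforce
  show ?case
  proof (cases "m = 2")
    case True
    then show ?thesis using skip[of i] less.prems by simp
  next
    case False
    then have m: "3 \<le> m" using less.prems by simp
    have neq: "vs ! i \<noteq> vs ! (i + m)"
    proof
      assume "vs ! i = vs ! (i + m)"
      moreover have "{vs ! (i + (m - 1)), vs ! (i + m)} \<in> E"
        using edge[of "i + (m - 1)"] less.prems m by simp
      ultimately have "{vs ! i, vs ! (i + (m - 1))} \<in> E" by (simp add: insert_commute)
      moreover have "m - 1 < m" "i + (m - 1) < length vs" "2 \<le> m - 1"
        using less.prems m by auto
      ultimately show False using less.IH by blast
    qed
    moreover have "{vs ! i, vs ! (i + m)} \<notin> E"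
    proof
      assume chord: "{vs ! i, vs ! (i + m)} \<in> E"
      define us where "us = take (Suc m) (drop i vs)"
      have len: "length us = Suc m" using less.prems by (simp add: us_def)
      have nth: "us ! j = vs ! (i + j)" if "j \<le> m" for j
        using that less.prems by (simp add: us_def)
      have us_edge: "{us ! j, us ! Suc j} \<in> E" if "j < m" for j
        using that edge[of "i + j"] less.prems nth by simp
      \<comment> \<open>Only the end pair \<open>(0, m)\<close> of the window has distance
        \<open>m\<close>; consecutive pairs are edges, and all others fall under the induction
        hypothesis.\<close>
      have pair: "us ! j \<noteq> us ! k \<and> ({us ! j, us ! k} \<in> E \<longrightarrow> k = Suc j \<or> j = 0 \<and> k = m)"
        if "j < k" "k \<le> m" for j k
      proof -
        have "k = Suc j \<or> j = 0 \<and> k = m \<or> 2 \<le> k - j \<and> k - j < m"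
          using that by linarith
        then consider "k = Suc j" | "j = 0" "k = m" | "2 \<le> k - j" "k - j < m" by blast
        then show ?thesis
        proof cases
          case 1
          then show ?thesis using us_edge[of j] that neq_edge by auto
        next
          case 2
          then show ?thesis using neq nth[of 0] nth[of m] by simp
        next
          case 3
          then have "vs ! (i + j) \<noteq> vs ! (i + j + (k - j)) \<and> {vs ! (i + j), vs ! (i + j + (k - j))} \<notin> E"
            using less.IH[of "k - j" "i + j"] that less.prems by auto
          then show ?thesis using that nth by simp
        qed
      qed
      have dist: "distinct us"
        unfolding distinct_conv_nth
      proof (intro allI impI)
        fix j k assume "j < length us" "k < length us" "j \<noteq> k"
        then show "us ! j \<noteq> us ! k"
          using pair[of j k] pair[of k j] len by (cases j k rule: linorder_cases) auto
      qed
      let ?cyc = "{{us ! i, us ! (Suc i mod length us)} | i. i < length us}"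
      have "induced_edges E (set us) = ?cyc"
      proof (intro equalityI subsetI)
        fix e assume "e \<in> induced_edges E (set us)"
        then have e: "e \<in> E" "e \<subseteq> set us" "card e = 2"
          using E by (auto simp: induced_edges_def simple_graph_def)
        obtain j k where jk: "j < k" "k < length us" "e = {us ! j, us ! k}"
          using e doubleton_as_nth by metis
        have "k = Suc j \<or> j = 0 \<and> k = m" using pair[of j k] e jk len by auto
        then consider "k = Suc j" | "j = 0" "k = m" by blast
        then show "e \<in> ?cyc"
        proof cases
          case 1
          then show ?thesis using jk len by (auto intro!: exI[of _ j])
        next
          case 2
          \<comment> \<open>The chord is the closing edge of the cycle, listed at index
            \<open>m\<close>, where \<open>Suc m mod length us = 0\<close>.\<close>
          then show ?thesis using jk len by (auto intro!: exI[of _ m] simp: insert_commute)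
        qed
      next
        fix e assume "e \<in> ?cyc"
        then obtain j where j: "j < length us" "e = {us ! j, us ! (Suc j mod length us)}" by blast
        have "e \<in> E"
        proof (cases "j = m")
          case True
          then show ?thesis using j len chord nth[of 0] nth[of m] by (simp add: insert_commute)
        next
          case False
          then show ?thesis using j len us_edge[of j] by simp
        qed
        moreover have "e \<subseteq> set us" using j len by (auto intro!: nth_mem)
        ultimately show "e \<in> induced_edges E (set us)" by (simp add: induced_edges_def)
      qed
      moreover have "set us \<subseteq> V"
        using sub set_take_subset[of "Suc m" "drop i vs"] set_drop_subset[of i vs]
        unfolding us_def by blast
      ultimately have "induced_cycle V E (set us)"
        unfolding induced_cycle_def using dist len m by (intro conjI exI[of _ us]) auto
      moreover have "card (set us) \<ge> 4" using dist len m by (simp add: distinct_card)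
      ultimately show False using chordal by (auto simp: chordal_def)
    qed
    ultimately show ?thesis by blast
  qed
qed

text \<open>The edge between \<open>u\<close> and \<open>v\<close> is not tested: along a walk this
  happens one turn earlier, and at the first vertex \<open>u\<close> is isolated, so that only
  \<open>{v, w} \<in> E\<close> remains.\<close>

definition turn :: "'a set set \<Rightarrow> 'a \<Rightarrow> 'a \<Rightarrow> 'a \<Rightarrow> bool" where
  "turn E u v w \<longleftrightarrow> {v, w} \<in> E \<and> {u, w} \<notin> E \<and> u \<noteq> w"

lemma distinct_if_turning_walk:
  assumes E: "simple_graph V E" and chordal: "chordal V E" and sub: "set vs \<subseteq> V"
    and walk: "walk (turn E) p vs"
  shows "distinct vs"
    and "induced_edges E (set vs) = {{vs ! i, vs ! Suc i} | i. Suc i < length vs}" (is "_ = ?R")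
proof -
  have neq_edge: "x \<noteq> y" if "{x, y} \<in> E" for x y
    using that E unfolding simple_graph_def by fastforce
  have edge: "{vs ! i, vs ! Suc i} \<in> E" if "Suc i < length vs" for i
    using walk that by (auto simp: walk_iff_nth turn_def)
  have "vs ! i \<noteq> vs ! Suc (Suc i) \<and> {vs ! i, vs ! Suc (Suc i)} \<notin> E"
    if "Suc (Suc i) < length vs" for i
    using walk[unfolded walk_iff_nth, rule_format, of "Suc i"] that by (auto simp: turn_def)
  note far = walk_induced_in_chordal[OF E chordal sub edge this]
  have pair: "vs ! i \<noteq> vs ! j \<and> ({vs ! i, vs ! j} \<in> E \<longrightarrow> j = Suc i)"
    if "i < j" "j < length vs" for i j
  proof (cases "j = Suc i")
    case True
    then show ?thesis using edge[of i] that neq_edge by auto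
  next
    case False
    then show ?thesis using far[of i "j - i"] that by auto
  qed
  then show "distinct vs" unfolding distinct_conv_nth by (metis nat_neq_iff)
  show "induced_edges E (set vs) = ?R"
  proof (intro equalityI subsetI)
    fix e assume "e \<in> induced_edges E (set vs)"
    then have e: "e \<in> E" "e \<subseteq> set vs" "card e = 2"
      using E by (auto simp: induced_edges_def simple_graph_def)
    obtain j k where jk: "j < k" "k < length vs" "e = {vs ! j, vs ! k}"
      using e doubleton_as_nth by metis
    then show "e \<in> ?R" using pair[of j k] e(1) by blast
  next
    fix e assume "e \<in> ?R"
    then show "e \<in> induced_edges E (set vs)" using edge by (force simp: induced_edges_def)
  qed
qed

text \<open>In a distinct list an unordered pair determines its positions, and \<open>j < k\<close>
  rules out the reversed match. This separates path edges from chords and makes the listing of path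
  edges injective.\<close>

lemma doubleton_nth_eq:
  assumes "distinct vs" "Suc i < length vs" "j < length vs" "k < length vs" "j < k"
    and "{vs ! j, vs ! k} = {vs ! i, vs ! Suc i}"
  shows "i = j \<and> k = Suc i"
proof -
  have "vs ! j = vs ! i \<and> vs ! k = vs ! Suc i \<or> vs ! j = vs ! Suc i \<and> vs ! k = vs ! i"
    using assms(6) by (simp only: doubleton_eq_iff)
  then have "j = i \<and> k = Suc i \<or> j = Suc i \<and> k = i"
    using assms(2-4) nth_eq_iff_index_eq[OF assms(1)] Suc_lessD by metis
  then show ?thesis using assms(5) by linarith
qed

text \<open>A chord at distance two would be an edge of the induced subgraph, hence a consecutive
  pair of the list, which distinctness forbids.\<close>

lemma turning_walk_if_induced:
  assumes "distinct vs"
    and E: "induced_edges E (set vs) = {{vs ! i, vs ! Suc i} | i. Suc i < length vs}"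
    and virtual: "\<And>v. {p, v} \<notin> E" "p \<notin> set vs"
  shows "walk (turn E) p vs"
  unfolding walk_iff_nth
proof (intro allI impI)
  fix i assume i: "Suc i < length vs"
  have "{vs ! i, vs ! Suc i} \<in> induced_edges E (set vs)" using E i by blast
  moreover have "{(p # vs) ! i, vs ! Suc i} \<notin> E \<and> (p # vs) ! i \<noteq> vs ! Suc i"
  proof (cases i)
    case 0
    then show ?thesis using virtual i by (auto simp: in_set_conv_nth)
  next
    case (Suc j)
    have "{vs ! j, vs ! Suc i} \<notin> E"
    proof
      assume "{vs ! j, vs ! Suc i} \<in> E"
      then have "{vs ! j, vs ! Suc i} \<in> induced_edges E (set vs)"
        using i Suc by (auto simp: induced_edges_def)
      then obtain l where "{vs ! j, vs ! Suc i} = {vs ! l, vs ! Suc l}" "Suc l < length vs"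
        using E by auto
      then show False using doubleton_nth_eq[of vs l j "Suc i"] assms(1) i Suc by auto
    qed
    then show ?thesis using assms(1) i Suc by (simp add: nth_eq_iff_index_eq)
  qed
  ultimately show "turn E ((p # vs) ! i) (vs ! i) (vs ! Suc i)"
    by (simp add: turn_def induced_edges_def)
qed

section \<open>Path weights as sums along walks\<close>

definition edge_weight :: "'a set set \<Rightarrow> ('a set \<Rightarrow> rat) \<Rightarrow> 'a \<Rightarrow> 'a \<Rightarrow> rat" where
  "edge_weight E d u v = (if {u, v} \<in> E then d {u, v} else 0)"

text \<open>Every edge is charged to its later endpoint; the first vertex is charged with the
  virtual pair, which weighs 0.\<close>

lemma path_weight_eq_walk_sum:
  assumes dist: "distinct vs"
    and E: "induced_edges E (set vs) = {{vs ! i, vs ! Suc i} | i. Suc i < length vs}"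
    and virtual: "\<And>v. {p, v} \<notin> E"
  shows "path_weight E c d (set vs) = walk_sum (\<lambda>u v. c v + edge_weight E d u v) p vs"
proof -
  have "(\<Sum>v\<in>set vs. c v) = (\<Sum>i<length vs. c (vs ! i))"
    using sum.reindex_bij_betw[OF bij_betw_nth[OF dist refl refl], of c] by simp
  moreover have "(\<Sum>e\<in>induced_edges E (set vs). d e) =
    (\<Sum>i<length vs. edge_weight E d ((p # vs) ! i) (vs ! i))"
  proof (cases "length vs")
    case (Suc m)
    have "inj_on (\<lambda>i. {vs ! i, vs ! Suc i}) {..<m}"
    proof (rule inj_onI)
      fix i j assume "i \<in> {..<m}" "j \<in> {..<m}"
        and eq: "{vs ! i, vs ! Suc i} = {vs ! j, vs ! Suc j}"
      then have "Suc j < length vs" "i < length vs" "Suc i < length vs" using Suc by auto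
      from doubleton_nth_eq[OF dist this lessI eq] show "i = j" by blast
    qed
    moreover have edges: "induced_edges E (set vs) = (\<lambda>i. {vs ! i, vs ! Suc i}) ` {..<m}"
      unfolding E Suc by auto
    ultimately have "(\<Sum>e\<in>induced_edges E (set vs). d e) = (\<Sum>i<m. d {vs ! i, vs ! Suc i})"
      by (simp only: sum.reindex o_def)
    also have "\<dots> = (\<Sum>i<m. edge_weight E d (vs ! i) (vs ! Suc i))"
    proof (rule sum.cong)
      fix i assume "i \<in> {..<m}"
      then have "{vs ! i, vs ! Suc i} \<in> induced_edges E (set vs)" unfolding edges by (rule imageI)
      then show "d {vs ! i, vs ! Suc i} = edge_weight E d (vs ! i) (vs ! Suc i)"
        by (simp add: edge_weight_def induced_edges_def)
    qed simp
    finally show ?thesis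
      unfolding Suc sum.lessThan_Suc_shift using virtual by (simp add: edge_weight_def)
  next
    case 0
    then have "induced_edges E (set vs) = {}" unfolding E by simp
    then show ?thesis using 0 by simp
  qed
  ultimately show ?thesis by (simp add: path_weight_def walk_sum_nth sum.distrib)
qed

text \<open>Induced paths are turning walks without repetition, so competitors of length at most
  \<open>card V\<close> suffice; the positive factor \<open>D\<close> preserves the comparison of
  weights.\<close>

lemma max_weight_induced_path_if_optimal_walk:
  assumes G: "simple_graph V E" "chordal V E"
    and virtual: "p \<notin> V"
    and vs: "vs \<noteq> []" "set vs \<subseteq> V" "walk (turn E) p vs"
    and scaled: "0 < D" "\<And>u v. u \<in> insert p V \<Longrightarrow> v \<in> V \<Longrightarrow> of_int (wt u v) = of_int D * (c v + edge_weight E d u v)"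
    and opt: "\<And>ws. ws \<noteq> [] \<Longrightarrow> set ws \<subseteq> V \<Longrightarrow> length ws \<le> card V \<Longrightarrow> walk (turn E) p ws \<Longrightarrow>
      walk_sum wt p ws \<le> walk_sum wt p vs"
  shows "max_weight_induced_path V E c d (set vs)"
proof -
  have p: "{p, v} \<notin> E" for v using G(1) virtual by (auto simp: simple_graph_def)
  have scale: "of_int (walk_sum wt q ws) =
      of_int D * walk_sum (\<lambda>u v. c v + edge_weight E d u v) q ws"
    if "set ws \<subseteq> V" "q \<in> insert p V" for q ws
    using that by (induction ws arbitrary: q) (simp_all add: scaled(2) distrib_left)
  note vs_props = distinct_if_turning_walk[OF G vs(2,3)]
  have "induced_path V E (set vs)"
    unfolding induced_path_def using vs vs_props by blast
  moreover have "path_weight E c d W \<le> path_weight E c d (set vs)" if W: "induced_path V E W" for W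
  proof -
    obtain ws where ws: "ws \<noteq> []" "distinct ws" "set ws = W" "W \<subseteq> V"
      "induced_edges E (set ws) = {{ws ! i, ws ! Suc i} | i. Suc i < length ws}"
      using W unfolding induced_path_def by blast
    have fin: "finite V" using G(1) by (simp add: simple_graph_def)
    have "length ws \<le> card V"
      using ws card_mono[OF fin \<open>W \<subseteq> V\<close>] distinct_card[of ws] by simp
    moreover have "walk (turn E) p ws"
      using turning_walk_if_induced[OF ws(2,5) p] virtual ws by auto
    ultimately have "walk_sum wt p ws \<le> walk_sum wt p vs" using opt ws by simp
    then have "(of_int (walk_sum wt p ws) :: rat) \<le> of_int (walk_sum wt p vs)" by simp
    then show ?thesis
      using path_weight_eq_walk_sum[OF ws(2,5) p] path_weight_eq_walk_sum[OF vs_props p]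
        scale[of ws p] scale[of vs p] ws vs scaled(1) by (simp del: walk_sum.simps)
  qed
  ultimately show ?thesis by (simp add: max_weight_induced_path_def)
qed

section \<open>Weakest preconditions with polynomial cost\<close>

lemma len_le_if_abs_less: "\<bar>x\<bar> < 2 ^ m \<Longrightarrow> len x \<le> Suc m"
  unfolding len_def by (auto intro!: floorlog_leI simp: nat_less_iff)

lemma abs_less_if_len_le:
  assumes "len x \<le> m" shows "\<bar>x\<bar> < 2 ^ m"
proof -
  have "nat \<bar>x\<bar> < 2 ^ m"
    using assms floorlog_le_iff[of 2 "nat \<bar>x\<bar>" m] unfolding len_def by auto
  then show ?thesis by (simp add: nat_less_iff)
qed

lemma len_pos: "0 < len x"
  by (simp add: len_def)

text \<open>Floor division can enlarge a negative quotient in absolute value, but never beyond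
  \<open>x\<close>, since \<open>x * y \<le> x\<close> for \<open>x < 0 < y\<close>. A divisor 0
  yields 0.\<close>

lemma abs_div_le_abs: "\<bar>x div y\<bar> \<le> \<bar>x\<bar>" for x y :: int
proof -
  have *: "\<bar>x div y\<bar> \<le> \<bar>x\<bar>" if "0 < y" for x y :: int
  proof (cases "0 \<le> x")
    case True
    then show ?thesis using that zdiv_mono2[of x 1 y] by (simp add: pos_imp_zdiv_nonneg_iff)
  next
    case False
    then have "x * y \<le> x * 1" using that by (intro mult_left_mono_neg) auto
    then have "x * y div y \<le> x div y" using that by (intro zdiv_mono1) auto
    then show ?thesis using that False div_neg_pos_less0[of x y] by simp
  qed
  show ?thesis
    using *[of y x] *[of "- y" "- x"] by (cases y "0 :: int" rule: linorder_cases) auto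
qed

text \<open>Both lengths contain a sign bit and the result needs only one; the spare bit absorbs the
  carry of a sum or difference.\<close>

lemma len_apply_op: "len (apply_op f x y) \<le> len x + len y"
proof -
  define i where "i = floorlog 2 (nat \<bar>x\<bar>)"
  define j where "j = floorlog 2 (nat \<bar>y\<bar>)"
  have len: "len x = Suc i" "len y = Suc j" by (simp_all add: len_def i_def j_def)
  have "nat \<bar>x\<bar> < 2 ^ i" "nat \<bar>y\<bar> < 2 ^ j"
    using floorlog_le_iff[of 2 "nat \<bar>x\<bar>" i] floorlog_le_iff[of 2 "nat \<bar>y\<bar>" j]
    by (auto simp: i_def j_def)
  then have x: "\<bar>x\<bar> < 2 ^ i" and y: "\<bar>y\<bar> < 2 ^ j" by (simp_all add: nat_less_iff)
  define K where "K = (2::int) ^ (i + j)"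
  have "(2::int) ^ i \<le> K" "(2::int) ^ j \<le> K"
    by (simp_all add: K_def power_increasing)
  then have xK: "\<bar>x\<bar> < K" and yK: "\<bar>y\<bar> < K" using x y by linarith+
  have "\<bar>apply_op f x y\<bar> < 2 * K"
  proof (cases f)
    case Mul
    have "\<bar>x\<bar> * \<bar>y\<bar> < 2 ^ i * 2 ^ j"
      using x y by (intro mult_strict_mono) auto
    also have "\<dots> = K" by (simp add: K_def power_add)
    finally show ?thesis using Mul xK by (simp add: abs_mult)
  next
    case Div
    then show ?thesis using abs_div_le_abs[of x y] xK by simp
  qed (use xK yK in auto)
  then have "\<bar>apply_op f x y\<bar> < 2 ^ Suc (i + j)" by (simp add: K_def)
  then show ?thesis using len_le_if_abs_less len by fastforce
qed

section \<open>Cost relative to a bound on the length of all cells\<close>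

definition bounded_memory :: "nat \<Rightarrow> memory \<Rightarrow> bool" where
  "bounded_memory M s \<longleftrightarrow> (\<forall>b a. len (s b a) \<le> M)"

lemma bounded_memory_pos: "bounded_memory M s \<Longrightarrow> 0 < M"
  using len_pos less_le_trans unfolding bounded_memory_def by blast

lemma len_Read: "bounded_memory M s \<Longrightarrow> len (aval (Read b e) s) \<le> M"
  by (simp add: bounded_memory_def)

text \<open>A read contributes a single \<open>M\<close> whatever its address; the factors of the
  operands add up because lengths do so under every operation.\<close>

fun value_factor :: "aexp \<Rightarrow> nat" where
  "value_factor (Const k) = len k"
| "value_factor (Read b e) = 1"
| "value_factor (Op f e1 e2) = value_factor e1 + value_factor e2"

lemma len_aval: "bounded_memory M s \<Longrightarrow> len (aval e s) \<le> value_factor e * M"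
proof (induction e)
  case (Const k)
  then show ?case using bounded_memory_pos[of M s] by simp
next
  case (Read b e)
  then show ?case by (simp add: bounded_memory_def)
next
  case (Op f e1 e2)
  then show ?case
    using len_apply_op[of f "aval e1 s" "aval e2 s"] by (simp add: add_mult_distrib)
qed

text \<open>The factor 2 pays for the two operands and for the result, whose length is at most the
  sum of theirs.\<close>

fun cost_factor :: "aexp \<Rightarrow> nat" where
  "cost_factor (Const k) = len k"
| "cost_factor (Read b e) = cost_factor e + value_factor e + 1"
| "cost_factor (Op f e1 e2) =
     cost_factor e1 + cost_factor e2 + 2 * (value_factor e1 + value_factor e2)"

lemma acost_le: "bounded_memory M s \<Longrightarrow> acost e s \<le> cost_factor e * M"
proof (induction e)
  case (Const k)
  then show ?case using bounded_memory_pos[of M s] by simp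
next
  case (Read b e)
  then have "len (s b (aval e s)) \<le> M" by (simp add: bounded_memory_def)
  then show ?case using Read len_aval[of M s e] by (simp add: algebra_simps)
next
  case (Op f e1 e2)
  then show ?case
    using len_apply_op[of f "aval e1 s" "aval e2 s"] len_aval[of M s e1] len_aval[of M s e2]
    by (simp add: algebra_simps)
qed

abbreviation total_factor :: "aexp \<Rightarrow> nat" where
  "total_factor e \<equiv> cost_factor e + value_factor e"

lemma acost_len_le: "bounded_memory M s \<Longrightarrow> acost e s + len (aval e s) \<le> total_factor e * M"
  using acost_le[of M s e] len_aval[of M s e] by (simp add: add_mult_distrib)

text \<open>The variable of the polynomial stands for a bound on the number of iterations of every loop;
  its value is the cost relative to a bound on the length of all cells.\<close>

fun cost_poly :: "com \<Rightarrow> nat poly" where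
  "cost_poly Skip = 1"
| "cost_poly (Write b e1 e2) = [:total_factor e1 + total_factor e2:]"
| "cost_poly (Seq c1 c2) = cost_poly c1 + cost_poly c2"
| "cost_poly (If e c1 c2) = [:total_factor e:] + cost_poly c1 + cost_poly c2"
| "cost_poly (While e c) = [:total_factor e, total_factor e:] + [:0, 1:] * cost_poly c"

text \<open>The bound on all cells is both assumed and reestablished, so it passes silently through
  compositions, and only assignments leave an obligation about lengths.\<close>

definition wp :: "nat \<Rightarrow> nat \<Rightarrow> com \<Rightarrow> (memory \<Rightarrow> bool) \<Rightarrow> memory \<Rightarrow> bool" where
  "wp B M c Q s \<longleftrightarrow> (bounded_memory M s \<longrightarrow>
     (\<exists>t s'. exec c s t s' \<and> t \<le> poly (cost_poly c) B * M \<and> bounded_memory M s' \<and> Q s'))"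

lemma wp_mono: "wp B M c Q s \<Longrightarrow> (\<And>s'. Q s' \<Longrightarrow> R s') \<Longrightarrow> wp B M c R s"
  unfolding wp_def by blast

lemma wp_Skip: "Q s \<Longrightarrow> wp B M Skip Q s"
  using exec.Skip[of s] bounded_memory_pos[of M s] unfolding wp_def
  by (metis Suc_leI cost_poly.simps(1) mult_1 One_nat_def poly_1)

lemma wp_Write:
  assumes "bounded_memory M s \<Longrightarrow> len (aval e2 s) \<le> M"
    and "Q (s(b := (s b)(aval e1 s := aval e2 s)))"
  shows "wp B M (Write b e1 e2) Q s"
  unfolding wp_def
proof (intro impI exI conjI)
  assume M: "bounded_memory M s"
  show "exec (Write b e1 e2) s (acost e1 s + acost e2 s + len (aval e1 s) + len (aval e2 s))
    (s(b := (s b)(aval e1 s := aval e2 s)))" by (rule exec.Write)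
  show "acost e1 s + acost e2 s + len (aval e1 s) + len (aval e2 s)
      \<le> poly (cost_poly (Write b e1 e2)) B * M"
    using acost_len_le[OF M, of e1] acost_len_le[OF M, of e2] by (simp add: algebra_simps)
  show "bounded_memory M (s(b := (s b)(aval e1 s := aval e2 s)))"
    using M assms(1) by (auto simp: bounded_memory_def)
qed (use assms(2) in auto)

lemma wp_Seq:
  assumes "wp B M c1 (wp B M c2 Q) s" shows "wp B M (Seq c1 c2) Q s"
  unfolding wp_def
proof
  assume "bounded_memory M s"
  then obtain t1 s1 t2 s2 where
    "exec c1 s t1 s1" "t1 \<le> poly (cost_poly c1) B * M"
    "exec c2 s1 t2 s2" "t2 \<le> poly (cost_poly c2) B * M" "bounded_memory M s2" "Q s2"
    using assms unfolding wp_def by blast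
  then show "\<exists>t s'. exec (Seq c1 c2) s t s' \<and> t \<le> poly (cost_poly (Seq c1 c2)) B * M \<and>
      bounded_memory M s' \<and> Q s'"
    by (intro exI[of _ "t1 + t2"] exI[of _ s2]) (auto intro: exec.Seq simp: add_mult_distrib)
qed

lemma wp_Write_Seq:
  assumes "bounded_memory M s \<Longrightarrow> len (aval e2 s) \<le> M"
    and "wp B M c Q (s(b := (s b)(aval e1 s := aval e2 s)))"
  shows "wp B M (Seq (Write b e1 e2) c) Q s"
  using assms by (intro wp_Seq wp_Write)

lemma wp_If:
  assumes "aval e s \<noteq> 0 \<Longrightarrow> wp B M c1 Q s" and "aval e s = 0 \<Longrightarrow> wp B M c2 Q s"
  shows "wp B M (If e c1 c2) Q s"
  unfolding wp_def
proof
  assume M: "bounded_memory M s"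
  define c where "c = (if aval e s \<noteq> 0 then c1 else c2)"
  have "wp B M c Q s" using assms by (simp add: c_def)
  then obtain t s' where *: "exec c s t s'" "t \<le> poly (cost_poly c) B * M"
      "bounded_memory M s'" "Q s'"
    using M unfolding wp_def by blast
  have "exec (If e c1 c2) s (acost e s + len (aval e s) + t) s'"
    using *(1) exec.IfTrue[of e s c1 t s' c2] exec.IfFalse[of e s c2 t s' c1]
    by (cases "aval e s = 0") (simp_all add: c_def)
  moreover have "t \<le> (poly (cost_poly c1) B + poly (cost_poly c2) B) * M"
    using *(2) by (auto simp: c_def add_mult_distrib split: if_splits)
  then have "acost e s + len (aval e s) + t \<le> poly (cost_poly (If e c1 c2)) B * M"
    using acost_len_le[OF M, of e] by (simp add: algebra_simps)
  ultimately show "\<exists>t s'. exec (If e c1 c2) s t s' \<and> t \<le> poly (cost_poly (If e c1 c2)) B * M \<and>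
      bounded_memory M s' \<and> Q s'"
    using * by blast
qed

lemma wp_While:
  assumes body: "\<And>s. I s \<Longrightarrow> aval e s \<noteq> 0 \<Longrightarrow> wp B M c (\<lambda>s'. I s' \<and> m s' < m s) s"
    and exit: "\<And>s. I s \<Longrightarrow> aval e s = 0 \<Longrightarrow> Q s"
    and "I s" and "m s \<le> B"
  shows "wp B M (While e c) Q s"
  unfolding wp_def
proof
  let ?g = "total_factor e" and ?k = "poly (cost_poly c) B"
  \<comment> \<open>The claim uses \<open>m s\<close> in place of \<open>B\<close>, so that each
    round pays for one guard and one body; the extra \<open>?g\<close> is the final, failing
    guard.\<close>
  have *: "\<exists>t s'. exec (While e c) s t s' \<and> t \<le> (?g + m s * (?g + ?k)) * M \<and>
      bounded_memory M s' \<and> Q s'" if "I s" "bounded_memory M s" for s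
    using that
  proof (induction "m s" arbitrary: s rule: less_induct)
    case less
    note guard = acost_len_le[OF less.prems(2), of e]
    show ?case
    proof (cases "aval e s = 0")
      case True
      then show ?thesis
        using exec.WhileFalse[of e s c] guard exit less.prems
        by (intro exI[of _ "acost e s + len (aval e s)"] exI[of _ s]) (auto simp: algebra_simps)
    next
      case False
      then obtain t1 s1 where 1: "exec c s t1 s1" "t1 \<le> ?k * M" "bounded_memory M s1"
          "I s1" "m s1 < m s"
        using body[OF less.prems(1)] less.prems(2) unfolding wp_def by blast
      from less.hyps[OF 1(5) 1(4) 1(3)] obtain t2 s2 where
        2: "exec (While e c) s1 t2 s2" "t2 \<le> (?g + m s1 * (?g + ?k)) * M"
          "bounded_memory M s2" "Q s2" by blast
      have "t2 + (?g + ?k) * M \<le> (?g + Suc (m s1) * (?g + ?k)) * M"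
        using 2(2) by (simp add: algebra_simps)
      also have "\<dots> \<le> (?g + m s * (?g + ?k)) * M"
        using 1(5) by (intro mult_right_mono add_left_mono) auto
      finally have "acost e s + len (aval e s) + t1 + t2 \<le> (?g + m s * (?g + ?k)) * M"
        using guard 1(2) by (simp add: algebra_simps)
      then show ?thesis using exec.WhileTrue[OF False 1(1) 2(1)] 2 by blast
    qed
  qed
  assume "bounded_memory M s"
  from *[OF \<open>I s\<close> this] obtain t s' where
    1: "exec (While e c) s t s'" "t \<le> (?g + m s * (?g + ?k)) * M" "bounded_memory M s'" "Q s'"
    by blast
  have "(?g + m s * (?g + ?k)) * M \<le> (?g + B * (?g + ?k)) * M"
    using \<open>m s \<le> B\<close> by (intro mult_right_mono add_left_mono) auto
  also have "\<dots> = poly (cost_poly (While e c)) B * M" by (simp add: algebra_simps)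
  finally show "\<exists>t s'. exec (While e c) s t s' \<and> t \<le> poly (cost_poly (While e c)) B * M \<and>
      bounded_memory M s' \<and> Q s'"
    using 1 le_trans by blast
qed

section \<open>Program notation and counting loops\<close>

abbreviation var :: "nat \<Rightarrow> aexp" where "var b \<equiv> Read b (Const 0)"
abbreviation assign :: "nat \<Rightarrow> aexp \<Rightarrow> com" (infix "::=" 62) where
  "b ::= e \<equiv> Write b (Const 0) e"
abbreviation set_var :: "nat \<Rightarrow> int \<Rightarrow> memory \<Rightarrow> memory" where
  "set_var b x s \<equiv> s(b := (s b)(0 := x))"
abbreviation seq (infixr ";;" 60) where "c1 ;; c2 \<equiv> Seq c1 c2"
abbreviation add (infixl "\<oplus>" 65) where "a \<oplus> b \<equiv> Op Add a b"
abbreviation sub (infixl "\<ominus>" 65) where "a \<ominus> b \<equiv> Op Sub a b"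
abbreviation mul (infixl "\<otimes>" 70) where "a \<otimes> b \<equiv> Op Mul a b"
abbreviation quot (infixl "\<oslash>" 70) where "a \<oslash> b \<equiv> Op Div a b"
abbreviation less (infix "\<prec>" 50) where "a \<prec> b \<equiv> Op Lt a b"

definition For :: "nat \<Rightarrow> aexp \<Rightarrow> com \<Rightarrow> com" where
  "For b e c = (b ::= Const 0 ;; While (var b \<prec> e) (c ;; b ::= var b \<oplus> Const 1))"

text \<open>\<open>I i\<close> describes the memory whose counter is already \<open>i\<close>, so
  the body has to leave the counter alone and to establish \<open>I (Suc i)\<close> for the memory
  after the increment. As \<open>e\<close> is evaluated anew in every round, the invariant has to
  fix its value.\<close>

lemma wp_For:
  assumes init: "I 0 (set_var b 0 s)"
    and body: "\<And>i s. i < N \<Longrightarrow> I i s \<Longrightarrow> s b 0 = int i \<Longrightarrow>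
      wp B M c (\<lambda>s'. s' b 0 = int i \<and> I (Suc i) (set_var b (int (Suc i)) s')) s"
    and bound: "\<And>i s. I i s \<Longrightarrow> s b 0 = int i \<Longrightarrow> aval e s = int N"
    and exit: "\<And>s. I N s \<Longrightarrow> s b 0 = int N \<Longrightarrow> Q s"
    and "N \<le> B" and len: "\<And>i. i \<le> N \<Longrightarrow> len (int i) \<le> M"
  shows "wp B M (For b e c) Q s"
  unfolding For_def
proof (rule wp_Seq, rule wp_Write)
  let ?I = "\<lambda>s. \<exists>i \<le> N. s b 0 = int i \<and> I i s"
  show "wp B M (While (var b \<prec> e) (c ;; b ::= var b \<oplus> Const 1)) Q
    (s(b := (s b)(aval (Const 0) s := aval (Const 0) s)))"
  proof (rule wp_While[where I = ?I and m = "\<lambda>s. N - nat (s b 0)"])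
    fix s assume s: "?I s" and "aval (var b \<prec> e) s \<noteq> 0"
    then obtain i where i: "i < N" "s b 0 = int i" "I i s"
      using bound by (auto split: if_splits)
    show "wp B M (c ;; b ::= var b \<oplus> Const 1) (\<lambda>s'. ?I s' \<and> N - nat (s' b 0) < N - nat (s b 0)) s"
    proof (rule wp_Seq, rule wp_mono[OF body[OF i(1,3,2)]])
      fix s' assume s': "s' b 0 = int i \<and> I (Suc i) (set_var b (int (Suc i)) s')"
      show "wp B M (b ::= var b \<oplus> Const 1)
        (\<lambda>s'. ?I s' \<and> N - nat (s' b 0) < N - nat (s b 0)) s'"
      proof (rule wp_Write)
        show "len (aval (var b \<oplus> Const 1) s') \<le> M"
          using s' i(1) len[of "Suc i"] by (simp add: add.commute)
        show "?I (s'(b := (s' b)(aval (Const 0) s' := aval (var b \<oplus> Const 1) s'))) \<and>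
          N - nat ((s'(b := (s' b)(aval (Const 0) s' := aval (var b \<oplus> Const 1) s'))) b 0)
          < N - nat (s b 0)"
          using s' i by (auto intro!: exI[of _ "Suc i"] simp: add.commute nat_add_distrib)
      qed
    qed
  next
    fix s assume "?I s" "aval (var b \<prec> e) s = 0"
    then show "Q s" using bound exit by (fastforce split: if_splits)
  qed (use init \<open>N \<le> B\<close> in auto)
qed (use len[of 0] in simp)

section \<open>Dynamic programming\<close>

text \<open>Bank 9 holds the table of \<open>best_walk\<close>, bank 10 the successors that attain its values. The number
  \<open>n\<close> serves as the predecessor of the first vertex: its row of the adjacency matrix lies behind the
  input, where all cells are 0, so that it behaves like an isolated vertex.\<close>

abbreviation vN :: aexp where "vN \<equiv> var 0"
abbreviation vD :: aexp where "vD \<equiv> var 2"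
abbreviation vK :: aexp where "vK \<equiv> var 3"
abbreviation vU :: aexp where "vU \<equiv> var 4"
abbreviation vV :: aexp where "vV \<equiv> var 5"
abbreviation vW :: aexp where "vW \<equiv> var 6"
abbreviation vBest :: aexp where "vBest \<equiv> var 7"
abbreviation vArg :: aexp where "vArg \<equiv> var 8"

text \<open>The offset \<open>j\<close> is 1 for the adjacency bit, 2 for the numerator and 3 for the denominator.\<close>

definition entry_pos :: "int \<Rightarrow> int \<Rightarrow> int \<Rightarrow> int \<Rightarrow> int" where
  "entry_pos N j u v = j + 2 * N + 3 * (u * N + v)"

definition entry :: "int \<Rightarrow> aexp \<Rightarrow> aexp \<Rightarrow> aexp" where
  "entry j a b = Read 0 (Const j \<oplus> Const 2 \<otimes> vN \<oplus> Const 3 \<otimes> (a \<otimes> vN \<oplus> b))"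

lemma aval_entry [simp]:
  "aval (entry j a b) s = s 0 (entry_pos (s 0 0) j (aval a s) (aval b s))"
  by (simp add: entry_def entry_pos_def)

text \<open>Digits in base \<open>N + 1\<close>: \<open>u\<close> may be the virtual vertex
  \<open>N\<close>, for which base \<open>N\<close> would let cells collide.\<close>

definition cell_pos :: "int \<Rightarrow> int \<Rightarrow> int \<Rightarrow> int \<Rightarrow> int" where
  "cell_pos N k u v = (k * (N + 1) + u) * (N + 1) + v"

definition cell :: "aexp \<Rightarrow> aexp \<Rightarrow> aexp \<Rightarrow> aexp" where
  "cell k a b = (k \<otimes> (vN \<oplus> Const 1) \<oplus> a) \<otimes> (vN \<oplus> Const 1) \<oplus> b"

lemma aval_cell [simp]:
  "aval (cell k a b) s = cell_pos (s 0 0) (aval k s) (aval a s) (aval b s)"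
  by (simp add: cell_def cell_pos_def)

lemma mult_add_eq_iff:
  fixes q m :: int
  assumes "0 \<le> r" "r < m" "0 \<le> r'" "r' < m"
  shows "q * m + r = q' * m + r' \<longleftrightarrow> q = q' \<and> r = r'"
proof
  assume *: "q * m + r = q' * m + r'"
  have "q = (q * m + r) div m" "q' = (q' * m + r') div m" using assms by simp_all
  then show "q = q' \<and> r = r'" using * by auto
qed simp

lemma cell_pos_eq_iff [simp]:
  assumes "0 \<le> u" "u \<le> N" "0 \<le> v" "v \<le> N" "0 \<le> u'" "u' \<le> N" "0 \<le> v'" "v' \<le> N"
  shows "cell_pos N k u v = cell_pos N k' u' v' \<longleftrightarrow> k = k' \<and> u = u' \<and> v = v'"
  using assms by (simp add: cell_pos_def mult_add_eq_iff)

section \<open>The programs\<close>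

text \<open>In an encoded instance a non-edge contributes the factor 1, and an edge contributes its
  denominator twice. The virtual row is left out, since its denominators read as 0.\<close>

definition denominator_prog :: com where
  "denominator_prog =
     (2 ::= Const 1 ;;
      For 4 vN (2 ::= vD \<otimes> Read 0 (Const 2 \<oplus> Const 2 \<otimes> vU) ;;
        For 5 vN (2 ::= vD \<otimes> entry 3 vU vV)))"

definition scan :: "aexp \<Rightarrow> aexp \<Rightarrow> com" where
  "scan e a = For 6 vN
     (If (e \<otimes> (vBest \<prec> Read 9 a)) (7 ::= Read 9 a ;; 8 ::= vW) Skip)"

text \<open>Products act as conjunctions; the sum of the two comparisons is nonzero exactly for
  distinct vertices.\<close>

definition turn_exp :: aexp where
  "turn_exp = entry 1 vV vW \<otimes> (Const 1 \<ominus> entry 1 vU vW) \<otimes> ((vU \<prec> vW) \<oplus> (vW \<prec> vU))"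

text \<open>Dividing \<open>D\<close> before multiplying keeps the divisions exact. For the virtual
  predecessor the denominator cell is 0, and division by 0 makes the edge term vanish.\<close>

definition weight_exp :: aexp where
  "weight_exp = Read 0 (Const 1 \<oplus> Const 2 \<otimes> vV) \<otimes> (vD \<oslash> Read 0 (Const 2 \<oplus> Const 2 \<otimes> vV))
     \<oplus> entry 2 vU vV \<otimes> (vD \<oslash> entry 3 vU vV)"

text \<open>The preset best value 0 with successor \<open>n\<close> is the option to stop at the
  current vertex.\<close>

definition table_step :: com where
  "table_step =
     (7 ::= Const 0 ;; 8 ::= vN ;; scan turn_exp (cell vK vV vW) ;;
      Write 9 (cell (vK \<oplus> Const 1) vU vV) (weight_exp \<oplus> vBest) ;;
      Write 10 (cell (vK \<oplus> Const 1) vU vV) vArg)"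

definition table_prog :: com where
  "table_prog = For 3 vN (For 4 (vN \<oplus> Const 1) (For 5 vN table_step))"

text \<open>An induced path is nonempty and all weights may be negative, so the scan starts from the
  value of vertex 0 and not from 0.\<close>

definition start_prog :: com where
  "start_prog =
     (4 ::= vN ;; 7 ::= Read 9 (cell vN vN (Const 0)) ;; 8 ::= Const 0 ;;
      scan (Const 1) (cell vN vN vW) ;; 5 ::= vArg)"

definition trace_prog :: com where
  "trace_prog = For 3 vN (If (vV \<prec> vN)
     (Write 1 vV (Const 1) ;; 6 ::= Read 10 (cell (vN \<ominus> vK) vU vV) ;; 4 ::= vV ;; 5 ::= vW)
     Skip)"

definition path_prog :: com where
  "path_prog = (denominator_prog ;; table_prog ;; start_prog ;; trace_prog)"

text \<open>\<open>cond\<close> and \<open>val\<close> speak about all memories that agree with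
  \<open>s\<close> off the banks 6, 7, 8, because the scan changes those between evaluations. A new
  best value is strictly larger than the preset one, which later excludes successors taken from
  layer 0 of the table.\<close>

lemma wp_scan:
  fixes P :: "nat \<Rightarrow> bool" and f :: "nat \<Rightarrow> int"
  assumes N: "s 0 0 = int n" "n \<le> B" "\<And>i. i \<le> n \<Longrightarrow> len (int i) \<le> M"
    and cond: "\<And>s' w. (\<And>b. b \<notin> {6, 7, 8} \<Longrightarrow> s' b = s b) \<Longrightarrow> s' 6 0 = int w \<Longrightarrow> w < n \<Longrightarrow>
      aval e s' \<noteq> 0 \<longleftrightarrow> P w"
    and val: "\<And>s' w. (\<And>b. b \<notin> {6, 7, 8} \<Longrightarrow> s' b = s b) \<Longrightarrow> s' 6 0 = int w \<Longrightarrow> w < n \<Longrightarrow>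
      s' 9 (aval a s') = f w"
    and post: "\<And>s'. (\<And>b. b \<notin> {6, 7, 8} \<Longrightarrow> s' b = s b) \<Longrightarrow>
      (\<And>w. w < n \<Longrightarrow> P w \<Longrightarrow> f w \<le> s' 7 0) \<Longrightarrow> s 7 0 \<le> s' 7 0 \<Longrightarrow>
      s' 7 0 = s 7 0 \<and> s' 8 0 = s 8 0 \<or>
        (\<exists>w < n. P w \<and> s' 7 0 = f w \<and> s 7 0 < f w \<and> s' 8 0 = int w) \<Longrightarrow> Q s'"
  shows "wp B M (scan e a) Q s"
  unfolding scan_def
proof (rule wp_For[where N = n and I = "\<lambda>i s'. (\<forall>b. b \<notin> {6, 7, 8} \<longrightarrow> s' b = s b) \<and>
    (\<forall>w < i. P w \<longrightarrow> f w \<le> s' 7 0) \<and> s 7 0 \<le> s' 7 0 \<and>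
    (s' 7 0 = s 7 0 \<and> s' 8 0 = s 8 0 \<or>
      (\<exists>w < i. P w \<and> s' 7 0 = f w \<and> s 7 0 < f w \<and> s' 8 0 = int w))"], goal_cases)
  case (2 i s')
  then have *: "\<And>b. b \<notin> {6, 7, 8} \<Longrightarrow> s' b = s b" by simp
  note eqs = cond[OF * 2(3,1)] val[OF * 2(3,1)]
  show ?case
  proof (rule wp_If, goal_cases)
    case 1
    then have **: "P i" "s' 7 0 < f i" using eqs by (auto split: if_splits)
    show ?case
    proof (intro wp_Write_Seq wp_Write, goal_cases)
      case 1
      then show ?case by (simp add: bounded_memory_def)
    next
      case 2
      then show ?case using \<open>i < n\<close> \<open>s' 6 0 = int i\<close> N(3)[of i] by simp
    next
      case 3
      have "f w \<le> f i" if "w < i" "P w" for w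
      proof -
        have "f w \<le> s' 7 0" using that 2(2) by blast
        then show ?thesis using **(2) by simp
      qed
      then show ?case using 2 ** eqs by (auto simp: less_Suc_eq)
    qed
  next
    case new: 2
    then have "\<not> P i \<or> f i \<le> s' 7 0" using eqs by (auto split: if_splits)
    then show ?case
      using 2 by (intro wp_Skip) (auto simp: less_Suc_eq)
  qed
next
  case 1
  show ?case by simp
next
  case (3 i s')
  then have "s' 0 = s 0" by simp
  then show ?case using N by simp
next
  case (4 s')
  then show ?case by (intro post) simp_all
qed (use N in simp_all)

section \<open>The instance in memory and the common denominator\<close>

locale encoded_graph =
  fixes n :: nat and E :: "nat set set" and inp :: "int \<Rightarrow> int"
    and cnum cden :: "nat \<Rightarrow> int" and dnum dden :: "nat \<Rightarrow> nat \<Rightarrow> int" and L :: nat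
  assumes inp_0: "inp 0 = int n"
    and inp_vertex: "v < n \<Longrightarrow> inp (1 + 2 * int v) = cnum v" "v < n \<Longrightarrow> inp (2 + 2 * int v) = cden v"
    and inp_edge:
      "u \<le> n \<Longrightarrow> v < n \<Longrightarrow> inp (entry_pos (int n) 1 (int u) (int v)) = of_bool ({u, v} \<in> E)"
      "u \<le> n \<Longrightarrow> v < n \<Longrightarrow> inp (entry_pos (int n) 2 (int u) (int v)) = dnum u v"
      "u \<le> n \<Longrightarrow> v < n \<Longrightarrow> inp (entry_pos (int n) 3 (int u) (int v)) = dden u v"
    and cden_pos: "v < n \<Longrightarrow> 0 < cden v"
    and dden_pos: "u < n \<Longrightarrow> v < n \<Longrightarrow> 0 < dden u v"
    and dden_virtual: "v < n \<Longrightarrow> dden n v = 0"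
    and inp_less: "\<bar>inp i\<bar> < 2 ^ L"
    and n_less: "n < 2 ^ L"
    and L_pos: "0 < L"
begin

text \<open>\<open>D\<close> has \<open>n * (n + 1)\<close> factors below \<open>2 ^ L\<close>.
  Three more such factors cover a numerator, the two terms of a weight, and the at most
  \<open>n\<close> weights of a walk. The summand 2 is one bit for the sign and one for the
  non-strict bound.\<close>

definition max_len :: nat where
  "max_len = L * (n * (n + 1) + 3) + 2"

abbreviation Z :: int where "Z \<equiv> 2 ^ L"

lemma Z_ge_2: "2 \<le> Z"
  using L_pos power_increasing[of 1 L "2::int"] by simp

lemma len_le_max_len:
  assumes "\<bar>x\<bar> \<le> Z ^ (n * (n + 1) + 3)" shows "len x \<le> max_len"
proof -
  have "\<bar>x\<bar> \<le> 2 ^ (L * (n * (n + 1) + 3))" using assms by (simp only: power_mult)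
  also have "\<dots> < 2 ^ Suc (L * (n * (n + 1) + 3))" by simp
  finally show ?thesis using len_le_if_abs_less[of x] by (simp add: max_len_def)
qed

lemma len_le_max_len': "\<bar>x\<bar> \<le> Z ^ k \<Longrightarrow> k \<le> n * (n + 1) + 3 \<Longrightarrow> len x \<le> max_len"
  using power_increasing[of k "n * (n + 1) + 3" Z] Z_ge_2 by (intro len_le_max_len) linarith

lemma len_counter: "i \<le> Suc n \<Longrightarrow> len (int i) \<le> max_len"
proof (rule len_le_max_len'[where k = 1])
  assume i: "i \<le> Suc n"
  have "int n < 2 ^ L" using n_less by (metis of_nat_less_iff of_nat_numeral of_nat_power)
  then show "\<bar>int i\<bar> \<le> Z ^ 1" using i by simp
qed simp

text \<open>The denominators of row \<open>i\<close> are numbered such that 0 is the one of the vertex \<open>i\<close> and \<open>Suc v\<close> the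
  one of the entry \<open>(i, v)\<close>; the rows before \<open>i\<close> and the first \<open>j\<close> denominators of row \<open>i\<close> divide \<open>D\<close>.\<close>

definition common_multiple :: "int \<Rightarrow> nat \<Rightarrow> nat \<Rightarrow> bool" where
  "common_multiple D i j \<longleftrightarrow> 0 < D \<and>
     (\<forall>u < n. u < i \<or> u = i \<and> 0 < j \<longrightarrow> cden u dvd D) \<and>
     (\<forall>u < n. \<forall>v < n. u < i \<or> u = i \<and> Suc v < j \<longrightarrow> dden u v dvd D)"

lemma common_multiple_mult:
  assumes D: "common_multiple D i j" "D \<le> Z ^ k" "0 < x" "x < Z"
    and "j = 0 \<Longrightarrow> i < n \<Longrightarrow> x = cden i" and "\<And>v. j = Suc v \<Longrightarrow> v < n \<Longrightarrow> x = dden i v"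
  shows "common_multiple (D * x) i (Suc j) \<and> D * x \<le> Z ^ Suc k"
proof -
  have "D * x \<le> Z ^ k * Z"
    using D by (intro mult_mono) (auto simp: common_multiple_def)
  then show ?thesis
    using assms unfolding common_multiple_def by (auto simp: less_Suc_eq mult.commute)
qed

text \<open>The exponent counts the factors so far: each finished row contributes one vertex
  denominator and \<open>n\<close> matrix denominators.\<close>

lemma wp_multiply:
  assumes D: "common_multiple (s 2 0) i j" "s 2 0 \<le> Z ^ (i * (n + 1) + j)" and "i < n" "j \<le> n"
    and x: "0 < aval e s" "aval e s < Z"
      "j = 0 \<Longrightarrow> aval e s = cden i" "\<And>v. j = Suc v \<Longrightarrow> v < n \<Longrightarrow> aval e s = dden i v"
    and post: "common_multiple (s 2 0 * aval e s) i (Suc j) \<Longrightarrow>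
      s 2 0 * aval e s \<le> Z ^ (i * (n + 1) + Suc j) \<Longrightarrow> Q (set_var 2 (s 2 0 * aval e s) s)"
  shows "wp B max_len (2 ::= vD \<otimes> e) Q s"
proof (rule wp_Write)
  have *: "common_multiple (s 2 0 * aval e s) i (Suc j)"
      "s 2 0 * aval e s \<le> Z ^ (i * (n + 1) + Suc j)"
    using common_multiple_mult[OF D x(1,2)] x(3,4) by simp_all
  show "Q (s(2 := (s 2)(aval (Const 0) s := aval (vD \<otimes> e) s)))"
    using post[OF *] by simp
  have "Suc i * (n + 1) \<le> n * (n + 1)" using \<open>i < n\<close> by (intro mult_right_mono) auto
  then have exponent: "i * (n + 1) + Suc j \<le> n * (n + 1) + 3" using \<open>j \<le> n\<close> by simp
  have "\<bar>s 2 0 * aval e s\<bar> \<le> Z ^ (i * (n + 1) + Suc j)"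
    using * by (simp add: common_multiple_def)
  from len_le_max_len'[OF this exponent] show "len (aval (vD \<otimes> e) s) \<le> max_len" by simp
qed

lemma common_multiple_Suc_row: "common_multiple D i (Suc n) \<Longrightarrow> common_multiple D (Suc i) 0"
  by (auto simp: common_multiple_def less_Suc_eq[of _ i])

text \<open>Banks 1 and 9 are carried along because the later programs rely on them being blank: as
  the empty output and as layer 0 of the table.\<close>

lemma wp_denominator_prog:
  assumes s: "s 0 = inp" "s 1 = (\<lambda>_. 0)" "s 9 = (\<lambda>_. 0)" and "n \<le> B"
    and post: "\<And>s. s 0 = inp \<Longrightarrow> s 1 = (\<lambda>_. 0) \<Longrightarrow> s 9 = (\<lambda>_. 0) \<Longrightarrow>
      common_multiple (s 2 0) n 0 \<Longrightarrow> s 2 0 \<le> Z ^ (n * (n + 1)) \<Longrightarrow> Q s"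
  shows "wp B max_len denominator_prog Q s"
  unfolding denominator_prog_def
proof (rule wp_Write_Seq, goal_cases)
  case 1
  show ?case using len_counter[of 1] by simp
next
  case 2
  let ?C = "\<lambda>i j s. s 0 = inp \<and> s 1 = (\<lambda>_. 0) \<and> s 9 = (\<lambda>_. 0) \<and>
    common_multiple (s 2 0) i j \<and> s 2 0 \<le> Z ^ (i * (n + 1) + j)"
  show ?case
  proof (rule wp_For[where N = n and I = "\<lambda>i. ?C i 0"], goal_cases)
    case 1
    then show ?case using s by (simp add: common_multiple_def)
  next
    case (2 i s)
    have eq: "aval (Read 0 (Const 2 \<oplus> Const 2 \<otimes> vU)) s = cden i"
      using 2 inp_vertex(2)[of i] by simp
    have less: "cden i < Z"
      using inp_less[of "2 + 2 * int i"] inp_vertex(2)[of i] 2 by simp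
    show ?case
    proof (rule wp_Seq, rule wp_multiply[where i = i and j = 0], unfold eq, goal_cases)
      case 9
      then have "?C i 1 (set_var 2 (s 2 0 * cden i) s)" using 2 by simp
      then show ?case
      proof (intro wp_For[where N = n and I = "\<lambda>j s. s 4 0 = int i \<and> ?C i (Suc j) s"], goal_cases)
        case 1
        then show ?case using 2 by simp
      next
        case (2 j s)
        have eq: "aval (entry 3 vU vV) s = dden i j"
          using 2 inp_edge(3)[of i j] inp_0 \<open>i < n\<close> by simp
        have less: "dden i j < Z"
          using inp_less[of "entry_pos (int n) 3 (int i) (int j)"] inp_edge(3)[of i j] 2 \<open>i < n\<close>
          by simp
        show ?case
        proof (rule wp_multiply[where i = i and j = "Suc j"], unfold eq, goal_cases)
          case 9
          then show ?case using 2 by simp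
        qed (use 2 \<open>i < n\<close> less dden_pos in auto)
      next
        case (4 s)
        then have "common_multiple (s 2 0) (Suc i) 0" using common_multiple_Suc_row by blast
        then show ?case using 4 by (simp add: algebra_simps)
      qed (use \<open>n \<le> B\<close> inp_0 len_counter in auto)
    qed (use 2 less cden_pos in auto)
  next
    case (4 s)
    then show ?case using post by simp
  qed (use \<open>n \<le> B\<close> inp_0 len_counter in auto)
qed

end

section \<open>Correctness of the table and of the traced walk\<close>

locale scaled_graph = encoded_graph +
  fixes D :: int
  assumes D: "common_multiple D n 0" "D \<le> Z ^ (n * (n + 1))"
begin

definition wt :: "nat \<Rightarrow> nat \<Rightarrow> int" where
  "wt u v = cnum v * (D div cden v) + dnum u v * (D div dden u v)"

abbreviation opt :: "nat \<Rightarrow> nat \<Rightarrow> nat \<Rightarrow> int" where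
  "opt \<equiv> best_walk (turn E) wt {..<n}"

lemma abs_wt_le:
  assumes "u \<le> n" "v < n" shows "\<bar>wt u v\<bar> \<le> 2 * Z ^ (n * (n + 1) + 1)"
proof -
  have *: "\<bar>a * (D div b)\<bar> \<le> Z ^ (n * (n + 1) + 1)" if "\<bar>a\<bar> < Z" for a b
  proof -
    have "\<bar>a\<bar> * \<bar>D div b\<bar> \<le> Z * Z ^ (n * (n + 1))"
      using that D abs_div_le_abs[of D b]
      by (intro mult_mono) (auto simp: common_multiple_def)
    then show ?thesis by (simp add: abs_mult)
  qed
  have "\<bar>cnum v\<bar> < Z" "\<bar>dnum u v\<bar> < Z"
    using assms inp_vertex(1)[of v] inp_edge(2)[of u v] inp_less by metis+
  then show ?thesis
    unfolding wt_def using *[of "cnum v" "cden v"] *[of "dnum u v" "dden u v"] by linarith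
qed

lemma abs_opt_le:
  assumes "k \<le> n" "u \<le> n" "v < n"
  shows "\<bar>opt k u v\<bar> \<le> Z ^ (n * (n + 1) + 3)"
proof -
  have "int n < 2 ^ L" using n_less by (metis of_nat_less_iff of_nat_numeral of_nat_power)
  have "\<bar>opt k u v\<bar> \<le> int k * (2 * Z ^ (n * (n + 1) + 1))"
    using abs_wt_le assms by (intro abs_best_walk_le[where U = "{..n}"]) auto
  also have "\<dots> \<le> Z * (Z * Z ^ (n * (n + 1) + 1))"
  proof (rule mult_mono)
    show "int k \<le> Z" using assms \<open>int n < 2 ^ L\<close> by linarith
    show "2 * Z ^ (n * (n + 1) + 1) \<le> Z * Z ^ (n * (n + 1) + 1)"
      by (rule mult_right_mono[OF Z_ge_2]) simp
  qed simp_all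
  also have "\<dots> = Z ^ (n * (n + 1) + 3)" by (simp add: numeral_3_eq_3)
  finally show ?thesis .
qed

text \<open>The value \<open>n\<close> in the table of successors says that the walk stops.\<close>

definition next_ok :: "nat \<Rightarrow> nat \<Rightarrow> nat \<Rightarrow> int \<Rightarrow> bool" where
  "next_ok k u v m \<longleftrightarrow> m = int n \<and> opt k u v = wt u v \<or>
     (\<exists>w < n. m = int w \<and> 1 < k \<and> turn E u v w \<and> opt k u v = wt u v + opt (k - 1) v w)"

text \<open>\<open>(Suc k, u, v)\<close> is the next cell in the lexicographic order in which the
  table is written; layer 0 carries no successors.\<close>

definition filled :: "nat \<Rightarrow> nat \<Rightarrow> nat \<Rightarrow> memory \<Rightarrow> bool" where
  "filled k u v s \<longleftrightarrow> (\<forall>k' u' v'. u' \<le> n \<longrightarrow> v' < n \<longrightarrow>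
     k' \<le> k \<or> k' = Suc k \<and> (u' < u \<or> u' = u \<and> v' < v) \<longrightarrow>
     s 9 (cell_pos (int n) (int k') (int u') (int v')) = opt k' u' v' \<and>
     (0 < k' \<longrightarrow> next_ok k' u' v' (s 10 (cell_pos (int n) (int k') (int u') (int v')))))"

lemma filled_update:
  assumes "filled k u v s" "u \<le> n" "v < n" "next_ok (Suc k) u v m"
  shows "filled k u (Suc v) (s
    (9 := (s 9)(cell_pos (int n) (int k + 1) (int u) (int v) := opt (Suc k) u v),
     10 := (s 10)(cell_pos (int n) (int k + 1) (int u) (int v) := m)))"
  unfolding filled_def
proof (intro allI impI, goal_cases)
  case (1 k' u' v')
  show ?case
  proof (cases "k' = Suc k \<and> u' = u \<and> v' = v")
    case True
    then show ?thesis using assms by (simp add: add.commute)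
  next
    case False
    then have "k' \<le> k \<or> k' = Suc k \<and> (u' < u \<or> u' = u \<and> v' < v)"
      using 1 by (auto simp: less_Suc_eq)
    then have "s 9 (cell_pos (int n) (int k') (int u') (int v')) = opt k' u' v' \<and>
        (0 < k' \<longrightarrow> next_ok k' u' v' (s 10 (cell_pos (int n) (int k') (int u') (int v'))))"
      using 1 assms(1) unfolding filled_def by blast
    moreover have "cell_pos (int n) (int k') (int u') (int v') \<noteq>
        cell_pos (int n) (int k + 1) (int u) (int v)"
      using False 1 assms(2,3) by auto
    ultimately show ?thesis by (simp del: best_walk.simps)
  qed
qed

lemma filled_cong: "s' 9 = s 9 \<Longrightarrow> s' 10 = s 10 \<Longrightarrow> filled k u v s' = filled k u v s"
  by (simp add: filled_def)

lemma filled_fun_upd [simp]: "b \<noteq> 9 \<Longrightarrow> b \<noteq> 10 \<Longrightarrow> filled k u v (s(b := x)) = filled k u v s"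
  by (rule filled_cong) simp_all

lemma filled_Suc_row: "filled k u n s \<Longrightarrow> filled k (Suc u) 0 s"
  unfolding filled_def by (auto simp: less_Suc_eq simp del: best_walk.simps)

lemma filled_Suc: "filled k (Suc n) 0 s \<Longrightarrow> filled (Suc k) 0 0 s"
  unfolding filled_def by (auto simp: le_Suc_eq less_Suc_eq_le simp del: best_walk.simps)

lemma filledD:
  assumes "filled n 0 0 s" "k \<le> n" "u \<le> n" "v < n"
  shows "s 9 (cell_pos (int n) (int k) (int u) (int v)) = opt k u v"
    and "0 < k \<Longrightarrow> next_ok k u v (s 10 (cell_pos (int n) (int k) (int u) (int v)))"
  using assms unfolding filled_def by blast+

lemma aval_weight_exp:
  assumes "s 0 = inp" "s 2 0 = D" "s 4 0 = int u" "s 5 0 = int v" "u \<le> n" "v < n"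
  shows "aval weight_exp s = wt u v"
  using assms inp_vertex[of v] inp_edge(2,3)[of u v] inp_0
  by (simp add: weight_exp_def wt_def)

lemma aval_turn_exp:
  assumes "s 0 = inp" "s 4 0 = int u" "s 5 0 = int v" "s 6 0 = int w" "u \<le> n" "v < n" "w < n"
  shows "aval turn_exp s \<noteq> 0 \<longleftrightarrow> turn E u v w"
  using assms inp_edge(1)[of u w] inp_edge(1)[of v w] inp_0
  by (auto simp: turn_exp_def turn_def)

lemma wp_table_step:
  assumes s: "s 0 = inp" "s 1 = (\<lambda>_. 0)" "s 2 0 = D" "s 3 0 = int k" "s 4 0 = int u" "s 5 0 = int v"
    and le: "k < n" "u \<le> n" "v < n" and filled: "filled k u v s" and "n \<le> B"
    and post: "\<And>s'. s' 0 = inp \<Longrightarrow> s' 1 = (\<lambda>_. 0) \<Longrightarrow> s' 2 0 = D \<Longrightarrow> s' 3 0 = int k \<Longrightarrow>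
      s' 4 0 = int u \<Longrightarrow> s' 5 0 = int v \<Longrightarrow> filled k u (Suc v) s' \<Longrightarrow> Q s'"
  shows "wp B max_len table_step Q s"
  unfolding table_step_def
proof (intro wp_Write_Seq, goal_cases)
  case 3
  show ?case
  proof (rule wp_Seq, rule wp_scan[where n = n and P = "turn E u v" and f = "opt k v"], goal_cases)
    case (4 s' w)
    then show ?case using s le 4(1)[of 0] 4(1)[of 4] 4(1)[of 5]
      by (intro aval_turn_exp) simp_all
  next
    case (5 s' w)
    then show ?case
      using s le inp_0 filled 5(1)[of 0] 5(1)[of 3] 5(1)[of 5] 5(1)[of 9] unfolding filled_def by simp
  next
    case (6 s')
    let ?S = "insert 0 (opt k v ` {w \<in> {..<n}. turn E u v w})"
    have same: "s' b = s b" if "b \<notin> {6, 7, 8}" for b using 6(1)[of b] that by simp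
    have s': "s' 0 = inp" "s' 1 = (\<lambda>_. 0)" "s' 2 0 = D" "s' 3 0 = int k" "s' 4 0 = int u"
        "s' 5 0 = int v" and filled': "filled k u v s'"
      using same s filled filled_cong[of s' s] by simp_all
    have "Max ?S = s' 7 0"
      using 6 by (intro Max_eqI) auto
    then have opt: "opt (Suc k) u v = wt u v + s' 7 0" by simp
    \<comment> \<open>All values of layer 0 are 0, so a strictly better successor exists only for
      \<open>k > 0\<close>; this is the condition \<open>1 < Suc k\<close> in
      \<open>next_ok\<close>.\<close>
    have k: "0 < k" if "0 < opt k v w" for w using that by (cases k) auto
    have next_ok: "next_ok (Suc k) u v (s' 8 0)"
      unfolding next_ok_def opt using 6(4) inp_0 s k by auto
    have weight: "aval (weight_exp \<oplus> vBest) s' = opt (Suc k) u v"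
      using aval_weight_exp[of s' u v] s' le opt by simp
    have pos: "aval (cell (vK \<oplus> Const 1) vU vV) s' = cell_pos (int n) (int k + 1) (int u) (int v)"
      using s' inp_0 by simp
    show ?case
    proof (intro wp_Write_Seq wp_Write, goal_cases)
      case 1
      then show ?case
        unfolding weight using abs_opt_le[of "Suc k" u v] le by (intro len_le_max_len) simp
    next
      case 2
      have "\<exists>i \<le> Suc n. s' 8 0 = int i"
        using next_ok unfolding next_ok_def by (meson le_SucI less_imp_le order_refl)
      then show ?case using len_counter by auto
    next
      case 3
      show ?case
        using filled_update[OF filled' le(2,3) next_ok] s' inp_0
        unfolding weight pos by (intro post) (simp_all del: best_walk.simps)
    qed
  qed (use s inp_0 len_counter \<open>n \<le> B\<close> in simp_all)
qed (use s inp_0 len_counter[of 0] len_counter[of n] in simp_all)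

text \<open>The strict bound \<open>n < B\<close> is due to the loop over the predecessors, which
  makes \<open>n + 1\<close> rounds.\<close>

lemma wp_table_prog:
  assumes s: "s 0 = inp" "s 1 = (\<lambda>_. 0)" "s 9 = (\<lambda>_. 0)" "s 2 0 = D" and "n < B"
    and post: "\<And>s. s 0 = inp \<Longrightarrow> s 1 = (\<lambda>_. 0) \<Longrightarrow> filled n 0 0 s \<Longrightarrow> Q s"
  shows "wp B max_len table_prog Q s"
  unfolding table_prog_def
proof (rule wp_For[where N = n and I = "\<lambda>k s. s 0 = inp \<and> s 1 = (\<lambda>_. 0) \<and> s 2 0 = D \<and> filled k 0 0 s"],
    goal_cases)
  case 1
  \<comment> \<open>Layer 0 is never written: the blank bank 9 already holds its values.\<close>
  then show ?case using s by (simp add: filled_def)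
next
  case (2 k s)
  show ?case
  proof (rule wp_For[where N = "Suc n" and I = "\<lambda>u s. s 0 = inp \<and> s 1 = (\<lambda>_. 0) \<and>
      s 2 0 = D \<and> s 3 0 = int k \<and> filled k u 0 s"], goal_cases)
    case 1
    then show ?case using 2 by (simp add: filled_def)
  next
    case (2 u s)
    show ?case
    proof (rule wp_For[where N = n and I = "\<lambda>v s. s 0 = inp \<and> s 1 = (\<lambda>_. 0) \<and> s 2 0 = D \<and>
        s 3 0 = int k \<and> s 4 0 = int u \<and> filled k u v s"], goal_cases)
      case 1
      then show ?case using 2 by simp
    next
      case (2 v s)
      then show ?case
        using \<open>k < n\<close> \<open>u < Suc n\<close> \<open>n < B\<close>
        by (intro wp_table_step[of s k u v]) simp_all
    next
      case (4 s)
      then show ?case by (simp add: filled_Suc_row)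
    qed (use \<open>n < B\<close> inp_0 len_counter in simp_all)
  next
    case (4 s)
    then show ?case by (simp add: filled_Suc)
  qed (use \<open>n < B\<close> inp_0 len_counter in simp_all)
next
  case (4 s)
  then show ?case using post by simp
qed (use \<open>n < B\<close> inp_0 len_counter in simp_all)

lemma wp_start_prog:
  assumes s: "s 0 = inp" "s 1 = (\<lambda>_. 0)" "filled n 0 0 s" and "n \<le> B"
    and post: "\<And>s' v. s' 0 = inp \<Longrightarrow> s' 1 = (\<lambda>_. 0) \<Longrightarrow> filled n 0 0 s' \<Longrightarrow>
      s' 4 0 = int n \<Longrightarrow> s' 5 0 = int v \<Longrightarrow> (0 < n \<Longrightarrow> v < n) \<Longrightarrow>
      (\<And>w. w < n \<Longrightarrow> opt n n w \<le> opt n n v) \<Longrightarrow> Q s'"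
  shows "wp B max_len start_prog Q s"
  unfolding start_prog_def
proof (intro wp_Write_Seq, goal_cases)
  case 1
  show ?case using s inp_0 len_counter by simp
next
  case 2
  then show ?case by (rule len_Read)
next
  case 3
  show ?case using len_counter[of 0] by simp
next
  case 4
  show ?case
  proof (rule wp_Seq, rule wp_scan[where n = n and P = "\<lambda>_. True" and f = "opt n n"], goal_cases)
    case (5 s' w)
    then show ?case
      using s inp_0 5(1)[of 0] 5(1)[of 9] filledD(1)[OF s(3), of n n w] by simp
  next
    case (6 s')
    have same: "s' b = s b" if "b \<notin> {4, 6, 7, 8}" for b using 6(1)[of b] that by simp
    have s': "s' 0 = inp" "s' 1 = (\<lambda>_. 0)" "s' 4 0 = int n" "filled n 0 0 s'"
      using same s inp_0 6(1)[of 4] s(3) filled_cong[of s' s] by simp_all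
    have "\<exists>v. s' 8 0 = int v \<and> (0 < n \<longrightarrow> v < n) \<and> (\<forall>w < n. opt n n w \<le> opt n n v)"
    proof (cases "n = 0")
      case True
      \<comment> \<open>Without vertices the scan makes no round, and the preset 0 remains without
        denoting a vertex.\<close>
      then show ?thesis using 6(4) by auto
    next
      case False
      have "s 9 (cell_pos (int n) (int n) (int n) 0) = opt n n 0"
        using filledD(1)[OF s(3), of n n 0] False by simp
      then show ?thesis using 6(2,4) s(1) inp_0 False by auto
    qed
    then obtain v where v: "s' 8 0 = int v" "0 < n \<Longrightarrow> v < n" "\<And>w. w < n \<Longrightarrow> opt n n w \<le> opt n n v"
      by blast
    show ?case
    proof (rule wp_Write, goal_cases)
      case 1
      then show ?case using v len_counter[of v] len_counter[of 0] 6(4)  by (auto simp: bounded_memory_def)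
    next
      case 2
      show ?case using s' v by (intro post[of _ v]) simp_all
    qed
  qed (use s inp_0 len_counter \<open>n \<le> B\<close> in simp_all)
qed

text \<open>After \<open>i\<close> steps, \<open>ys\<close> is the part of an optimal walk that has been traced, and \<open>v\<close> is the
  next vertex, with predecessor \<open>u\<close>.\<close>

definition traced :: "int \<Rightarrow> nat \<Rightarrow> memory \<Rightarrow> nat list \<Rightarrow> bool" where
  "traced r i s ys \<longleftrightarrow> set ys \<subseteq> {..<n} \<and> (\<forall>a. s 1 a \<noteq> 0 \<longleftrightarrow> a \<in> int ` set ys) \<and>
     walk (turn E) n ys \<and>
     (\<exists>v. s 4 0 = int (last (n # ys)) \<and> s 5 0 = int v \<and>
       (if v < n then i < n \<and> walk (turn E) n (ys @ [v]) \<and>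
            walk_sum wt n ys + opt (n - i) (last (n # ys)) v = r
        else 0 < n \<longrightarrow> ys \<noteq> [] \<and> walk_sum wt n ys = r))"

text \<open>The weight traced so far plus the optimum of the rest is invariant, since each recorded
  successor attains the maximum in the recursion of \<open>best_walk\<close>.\<close>

lemma wp_trace_prog:
  assumes s: "s 0 = inp" "s 1 = (\<lambda>_. 0)" "filled n 0 0 s" "s 4 0 = int n" "s 5 0 = int v"
    and "n \<le> B" and v: "0 < n \<Longrightarrow> v < n"
    and post: "\<And>s' ys. traced (opt n n v) n s' ys \<Longrightarrow> Q s'"
  shows "wp B max_len trace_prog Q s"
  unfolding trace_prog_def
proof (rule wp_For[where N = n and I = "\<lambda>i s. s 0 = inp \<and> filled n 0 0 s \<and>
    (\<exists>ys. traced (opt n n v) i s ys)"], goal_cases)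
  case 1
  have "traced (opt n n v) 0 (set_var 3 0 s) []"
    using s v by (auto simp: traced_def)
  then show ?case using s by auto
next
  case (2 i s)
  then obtain ys where "traced (opt n n v) i s ys" by blast
  then obtain w where ys: "set ys \<subseteq> {..<n}" "\<And>a. s 1 a \<noteq> 0 \<longleftrightarrow> a \<in> int ` set ys" "walk (turn E) n ys"
    and w: "s 4 0 = int (last (n # ys))" "s 5 0 = int w"
    and if_w: "if w < n then i < n \<and> walk (turn E) n (ys @ [w]) \<and>
            walk_sum wt n ys + opt (n - i) (last (n # ys)) w = opt n n v
        else 0 < n \<longrightarrow> ys \<noteq> [] \<and> walk_sum wt n ys = opt n n v"
    unfolding traced_def by blast
  define u where "u = last (n # ys)"
  have u: "u \<le> n" using ys(1) by (auto simp: u_def dest: last_in_set)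
  note w = w[folded u_def] note if_w = if_w[folded u_def]
  have filled: "filled n 0 0 s" using 2 by blast
  show ?case
  proof (rule wp_If, goal_cases)
    case 1
    then have "w < n" using 2 w inp_0 by (auto split: if_splits)
    then have i: "walk (turn E) n (ys @ [w])" "walk_sum wt n ys + opt (n - i) u w = opt n n v"
      using if_w by simp_all
    define m where "m = s 10 (cell_pos (int n) (int (n - i)) (int u) (int w))"
    have m: "next_ok (n - i) u w m"
      unfolding m_def using filledD(2)[OF filled, of "n - i" u w] u \<open>w < n\<close> \<open>i < n\<close> by simp
    then have "\<exists>x \<le> n. m = int x" unfolding next_ok_def by (auto intro: less_imp_le)
    then obtain x where x: "m = int x" "x \<le> n" by blast
    have pos: "s 10 (cell_pos (int n) (int n - int i) (int u) (int w)) = int x"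
      using x(1) \<open>i < n\<close> by (simp add: m_def)
    let ?s = "s(1 := (s 1)(int w := 1), 6 := (s 6)(0 := int x), 4 := (s 4)(0 := int w),
      5 := (s 5)(0 := int x), 3 := (s 3)(0 := int (Suc i)))"
    have "traced (opt n n v) (Suc i) ?s (ys @ [w])"
    proof -
      have "\<forall>a. ?s 1 a \<noteq> 0 \<longleftrightarrow> a \<in> int ` set (ys @ [w])" using ys(2) by auto
      \<comment> \<open>A successor \<open>x < n\<close> comes with \<open>1 < n - i\<close>, so a
        round is left for it; otherwise \<open>x = n\<close> and the weight is complete.\<close>
      moreover have "if x < n then Suc i < n \<and> walk (turn E) n ((ys @ [w]) @ [x]) \<and>
            walk_sum wt n (ys @ [w]) + opt (n - Suc i) w x = opt n n v
        else 0 < n \<longrightarrow> walk_sum wt n (ys @ [w]) = opt n n v"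
        using m i x walk_snoc[of "turn E" n ys w x] unfolding next_ok_def
        by (auto simp: walk_sum_snoc u_def simp del: best_walk.simps)
      ultimately show ?thesis
        unfolding traced_def using ys(1) i(1) \<open>w < n\<close>
        by (intro conjI exI[of _ x]) (auto simp del: best_walk.simps split: if_splits)
    qed
    moreover have "filled n 0 0 ?s" using filled by simp
    ultimately have inv: "s 0 = inp \<and> filled n 0 0 ?s \<and> (\<exists>ys. traced (opt n n v) (Suc i) ?s ys)"
      using 2 by blast
    have [simp]: "s 0 0 = int n" "s 3 0 = int i" using 2 inp_0 by simp_all
    note [simp] = w pos
    show ?case
    proof (intro wp_Write_Seq wp_Write, goal_cases)
      case 1
      show ?case using len_counter[of 1] by simp
    next
      case 2
      then show ?case by (rule len_Read)
    next
      case 3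
      show ?case using len_counter[of w] \<open>w < n\<close> by simp
    next
      case 4
      show ?case using len_counter[of x] x(2) by simp
    next
      case 5
      show ?case using inv by (simp add: inp_0)
    qed
  next
    case skip: 2
    then have "\<not> w < n" using 2 w inp_0 by (auto split: if_splits)
    then have "traced (opt n n v) (Suc i) (set_var 3 (int (Suc i)) s) ys"
      using ys w if_w unfolding traced_def by (auto simp: u_def simp del: best_walk.simps)
    moreover have "filled n 0 0 (set_var 3 (int (Suc i)) s)"
      using filled by simp
    ultimately show ?case using 2 by (intro wp_Skip) auto
  qed
next
  case (4 s)
  then show ?case using post by blast
qed (use inp_0 len_counter \<open>n \<le> B\<close> in simp_all)

end

lemma (in scaled_graph) wp_table_start_trace:
  assumes s: "s 0 = inp" "s 1 = (\<lambda>_. 0)" "s 9 = (\<lambda>_. 0)" "s 2 0 = D" and "n < B"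
    and post: "\<And>s' ys. (0 < n \<Longrightarrow> ys \<noteq> []) \<Longrightarrow> set ys \<subseteq> {..<n} \<Longrightarrow> walk (turn E) n ys \<Longrightarrow>
      (\<And>ws. ws \<noteq> [] \<Longrightarrow> set ws \<subseteq> {..<n} \<Longrightarrow> length ws \<le> n \<Longrightarrow> walk (turn E) n ws \<Longrightarrow>
        walk_sum wt n ws \<le> walk_sum wt n ys) \<Longrightarrow>
      output_set n s' = set ys \<Longrightarrow> Q s'"
  shows "wp B max_len (table_prog ;; start_prog ;; trace_prog) Q s"
proof (rule wp_Seq, rule wp_table_prog[OF s \<open>n < B\<close>], rule wp_Seq, rule wp_start_prog, goal_cases)
  case (5 s1 s2 v)
  show ?case
  proof (rule wp_trace_prog[OF 5(4-8)])
    fix s' ys assume ys: "traced (opt n n v) n s' ys"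
    show "Q s'"
    proof (rule post)
      show "0 < n \<Longrightarrow> ys \<noteq> []" "walk (turn E) n ys" and sub: "set ys \<subseteq> {..<n}"
        using ys unfolding traced_def by (auto split: if_splits)
      show "output_set n s' = set ys"
        using ys sub unfolding traced_def output_set_def by auto
      fix ws assume ws: "ws \<noteq> []" "set ws \<subseteq> {..<n}" "length ws \<le> n" "walk (turn E) n ws"
      then obtain w ws' where w: "ws = w # ws'" by (cases ws) auto
      then have "walk_sum wt n ws \<le> opt n n w"
        using walk_sum_le_best_walk[of "{..<n}" "turn E" n w ws' n wt] ws by simp
      also have "\<dots> \<le> opt n n v" using 5(10) ws(2) w by simp
      \<comment> \<open>After \<open>n\<close> rounds the branch demanding \<open>n < n\<close> is
        excluded, so the trace has stopped.\<close>
      also have "\<dots> = walk_sum wt n ys"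
        using ys w ws(3) unfolding traced_def by (auto split: if_splits)
      finally show "walk_sum wt n ws \<le> walk_sum wt n ys" .
    qed
  qed (use 5 \<open>n < B\<close> in auto)
qed (use \<open>n < B\<close> in auto)

lemma of_int_mult_div:
  assumes "b dvd D" shows "of_int (a * (D div b)) = of_int D * (of_int a / of_int b :: rat)"
  using assms by (auto simp: dvd_def)

lemma (in encoded_graph) wp_path_prog:
  assumes s: "s 0 = inp" "s 1 = (\<lambda>_. 0)" "s 9 = (\<lambda>_. 0)" and "n < B"
    and G: "simple_graph {..<n} E" "chordal {..<n} E"
    and c: "\<And>v. v < n \<Longrightarrow> c v = of_int (cnum v) / of_int (cden v)"
    and d: "\<And>u v. u \<le> n \<Longrightarrow> v < n \<Longrightarrow> edge_weight E d u v = of_int (dnum u v) / of_int (dden u v)"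
  shows "wp B max_len path_prog
    (\<lambda>s'. 0 < n \<longrightarrow> max_weight_induced_path {..<n} E c d (output_set n s')) s"
  unfolding path_prog_def
proof (rule wp_Seq, rule wp_denominator_prog[OF s], goal_cases)
  case (2 s)
  then interpret scaled_graph n E inp cnum cden dnum dden L "s 2 0"
    by unfold_locales
  show ?case
  proof (rule wp_table_start_trace, goal_cases)
    case (6 s' ys)
    have "max_weight_induced_path {..<n} E c d (set ys)" if "0 < n"
    proof (rule max_weight_induced_path_if_optimal_walk[OF G])
      show "0 < s 2 0" using D(1) by (simp add: common_multiple_def)
      fix u v assume "u \<in> insert n {..<n}" "v \<in> {..<n}"
      then have u: "u \<le> n" and v: "v < n" by auto
      have "of_int (cnum v * (s 2 0 div cden v)) = of_int (s 2 0) * c v"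
        unfolding c[OF v] using D(1) v by (intro of_int_mult_div) (simp add: common_multiple_def)
      moreover have "of_int (dnum u v * (s 2 0 div dden u v)) = of_int (s 2 0) * edge_weight E d u v"
      proof (cases "u = n")
        case True
        \<comment> \<open>Both sides vanish: the denominator is 0, and division by 0 gives 0 for
          integers and rationals alike.\<close>
        then show ?thesis using d[OF u v] dden_virtual[OF v] by simp
      next
        case False
        then show ?thesis
          unfolding d[OF u v] using D(1) u v by (intro of_int_mult_div) (simp add: common_multiple_def)
      qed
      ultimately show "of_int (wt u v) = of_int (s 2 0) * (c v + edge_weight E d u v)"
        unfolding wt_def by (simp add: distrib_left)
    qed (use 6 that in auto)
    then show ?case using 6 by simp
  qed (use 2 \<open>n < B\<close> in auto)
qed (use \<open>n < B\<close> in simp)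

section \<open>Encoded instances\<close>

lemma length_concat_map:
  assumes "\<And>x. x \<in> set ys \<Longrightarrow> length (f x) = m"
  shows "length (concat (map f ys)) = length ys * m"
  using assms by (induction ys) auto

lemma nth_concat_map:
  assumes "\<And>x. x \<in> set ys \<Longrightarrow> length (f x) = m" "i < length ys" "j < m"
  shows "concat (map f ys) ! (i * m + j) = f (ys ! i) ! j"
  using assms
proof (induction ys arbitrary: i)
  case (Cons y ys)
  then show ?case by (cases i) (auto simp: nth_append)
qed simp

text \<open>With \<open>edge_weight\<close>, edges and non-edges are encoded by the same expression,
  which makes the matrix uniform in its entries.\<close>

lemma encode_instance_eq:
  "encode_instance n E c d = int n # concat (map (\<lambda>v. encode_rat (c v)) [0..<n])
     @ concat (map (\<lambda>u. concat (map (\<lambda>v.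
         of_bool ({u, v} \<in> E) # encode_rat (edge_weight E d u v)) [0..<n])) [0..<n])"
  unfolding encode_instance_def edge_weight_def
  by (intro arg_cong2[where f = Cons] arg_cong2[where f = append] arg_cong[where f = concat] map_cong refl) simp

lemma length_encode_rat [simp]: "length (encode_rat r) = 2"
  by (simp add: encode_rat_def)

lemma length_encode_instance: "length (encode_instance n E c d) = 1 + 2 * n + 3 * (n * n)"
  unfolding encode_instance_eq
  by (simp add: length_concat_map[where m = 2] length_concat_map[where m = 3] length_concat_map[where m = "n * 3"])

lemma nth_encode_instance:
  assumes "v < n"
  shows "j < 2 \<Longrightarrow> encode_instance n E c d ! (1 + 2 * v + j) = encode_rat (c v) ! j"
    and "u < n \<Longrightarrow> j < 3 \<Longrightarrow> encode_instance n E c d ! (1 + j + 2 * n + 3 * (u * n + v)) =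
      (of_bool ({u, v} \<in> E) # encode_rat (edge_weight E d u v)) ! j"
proof -
  let ?A = "concat (map (\<lambda>v. encode_rat (c v)) [0..<n])"
  let ?row = "\<lambda>u. concat (map (\<lambda>v. of_bool ({u, v} \<in> E) # encode_rat (edge_weight E d u v)) [0..<n])"
  have A: "length ?A = n * 2" by (simp add: length_concat_map[where m = 2])
  have row: "length (?row u) = n * 3" for u by (simp add: length_concat_map[where m = 3])
  {
    assume "j < 2"
    then have "v * 2 + j < n * 2" using assms by linarith
    then have "encode_instance n E c d ! (1 + 2 * v + j) = ?A ! (v * 2 + j)"
      unfolding encode_instance_eq by (simp add: nth_append A mult.commute del: upt_Suc)
    also have "\<dots> = encode_rat (c v) ! j"
      using assms \<open>j < 2\<close> by (subst nth_concat_map) simp_all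
    finally show "encode_instance n E c d ! (1 + 2 * v + j) = encode_rat (c v) ! j" .
  }
  assume "u < n" "j < 3"
  then have "v * 3 + j < n * 3" using assms by linarith
  \<comment> \<open>Three cells per entry make rows of \<open>3 * n\<close> cells, so the index
    splits into two nested block offsets.\<close>
  have idx: "1 + j + 2 * n + 3 * (u * n + v) = Suc (length ?A + (u * (n * 3) + (v * 3 + j)))"
    unfolding A by (simp add: algebra_simps)
  have "encode_instance n E c d ! (1 + j + 2 * n + 3 * (u * n + v)) =
      concat (map ?row [0..<n]) ! (u * (n * 3) + (v * 3 + j))"
    unfolding encode_instance_eq idx nth_Cons_Suc nth_append_length_plus ..
  also have "\<dots> = ?row u ! (v * 3 + j)"
    using nth_concat_map[of "[0..<n]" ?row "n * 3" u "v * 3 + j"] row \<open>u < n\<close> \<open>v * 3 + j < n * 3\<close> by simp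
  also have "\<dots> = (of_bool ({u, v} \<in> E) # encode_rat (edge_weight E d u v)) ! j"
    using assms \<open>j < 3\<close> by (subst nth_concat_map) simp_all
  finally show "encode_instance n E c d ! (1 + j + 2 * n + 3 * (u * n + v)) =
      (of_bool ({u, v} \<in> E) # encode_rat (edge_weight E d u v)) ! j" .
qed

lemma initial_memory_int:
  "initial_memory xs 0 (int i) = (if i < length xs then xs ! i else 0)"
  by (simp add: initial_memory_def)

lemma len_le_input_size: "x \<in> set xs \<Longrightarrow> len x \<le> input_size xs"
  unfolding input_size_def by (rule member_le_sum_list) auto

lemma abs_initial_memory_less: "\<bar>initial_memory xs b i\<bar> < 2 ^ input_size xs"
  using abs_less_if_len_le[OF len_le_input_size, of _ xs] by (auto simp: initial_memory_def)

lemma length_le_input_size: "length xs \<le> input_size xs"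
  unfolding input_size_def by (induction xs) (simp_all add: len_def)

text \<open>\<open>input_size\<close> can serve as \<open>L\<close> because it bounds the length of
  each single cell, and \<open>n\<close> is itself stored in one.\<close>

lemma encoded_graph_encode_instance:
  assumes "simple_graph {..<n} E"
  shows "encoded_graph n E (initial_memory (encode_instance n E c d) 0)
    (\<lambda>v. fst (quotient_of (c v))) (\<lambda>v. snd (quotient_of (c v)))
    (\<lambda>u v. fst (quotient_of (edge_weight E d u v)))
    (\<lambda>u v. if u < n then snd (quotient_of (edge_weight E d u v)) else 0)
    (input_size (encode_instance n E c d))"
    (is "encoded_graph n E ?inp _ _ _ _ ?L")
proof
  let ?xs = "encode_instance n E c d"
  have nth: "?inp (int i) = (if i < length ?xs then ?xs ! i else 0)" for i
    by (rule initial_memory_int)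
  show inp_0: "?inp 0 = int n"
    using nth[of 0] by (simp add: length_encode_instance encode_instance_def)
  show "\<bar>?inp i\<bar> < 2 ^ ?L" for i by (rule abs_initial_memory_less)
  from this[of 0] have "int n < int (2 ^ ?L)" using inp_0 by simp
  then show "n < 2 ^ ?L" by (simp only: of_nat_less_iff)
  show "0 < ?L" using length_le_input_size[of ?xs] by (simp add: length_encode_instance)
  show "0 < snd (quotient_of (c v))" for v by (rule quotient_of_denom_pos')
  show "u < n \<Longrightarrow> 0 < (if u < n then snd (quotient_of (edge_weight E d u v)) else 0)" for u v
    by (simp add: quotient_of_denom_pos')
  show "(if n < n then snd (quotient_of (edge_weight E d n v)) else 0) = 0" for v by simp
  show "?inp (1 + 2 * int v) = fst (quotient_of (c v))"
    "?inp (2 + 2 * int v) = snd (quotient_of (c v))" if "v < n" for v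
    using that nth[of "1 + 2 * v"] nth[of "2 + 2 * v"] nth_encode_instance(1)[of v n 0 E c d]
      nth_encode_instance(1)[of v n 1 E c d]
    by (simp_all add: length_encode_instance encode_rat_def add.commute)
  have entry: "?inp (entry_pos (int n) (1 + int j) (int u) (int v)) =
      (if u < n then (of_bool ({u, v} \<in> E) # encode_rat (edge_weight E d u v)) ! j else 0)"
    if "u \<le> n" "v < n" "j < 3" for u v j
  proof -
    have pos: "entry_pos (int n) (1 + int j) (int u) (int v) = int (1 + j + 2 * n + 3 * (u * n + v))"
      by (simp add: entry_pos_def)
    show ?thesis
    proof (cases "u < n")
      case True
      have "Suc u * n \<le> n * n" using True by (intro mult_right_mono) auto
      then have "u * n + Suc v \<le> n * n" using that by simp
      then have "1 + j + 2 * n + 3 * (u * n + v) < length ?xs"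
        unfolding length_encode_instance using \<open>j < 3\<close> by (simp only: distrib_left)
      then show ?thesis unfolding pos nth using nth_encode_instance(2)[of v n u j] that True by simp
    next
      case False
      \<comment> \<open>Row \<open>n\<close> starts exactly behind the input, where all cells are
        0.\<close>
      then have "\<not> 1 + j + 2 * n + 3 * (u * n + v) < length ?xs"
        unfolding length_encode_instance using that by simp
      then show ?thesis unfolding pos nth using False by simp
    qed
  qed
  have virtual: "{n, v} \<notin> E" for v using assms by (auto simp: simple_graph_def)
  fix u v assume uv: "u \<le> n" "v < n"
  then have n: "u = n" if "\<not> u < n" using that by simp
  show "?inp (entry_pos (int n) 1 (int u) (int v)) = of_bool ({u, v} \<in> E)"
    using entry[OF uv, of 0] virtual n by auto
  show "?inp (entry_pos (int n) 2 (int u) (int v)) = fst (quotient_of (edge_weight E d u v))"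
    using entry[OF uv, of 1] virtual n by (auto simp: encode_rat_def edge_weight_def)
  show "?inp (entry_pos (int n) 3 (int u) (int v)) =
      (if u < n then snd (quotient_of (edge_weight E d u v)) else 0)"
    using entry[OF uv, of 2] by (simp add: encode_rat_def)
qed

lemma rat_eq_quotient_of: "r = of_int (fst (quotient_of r)) / of_int (snd (quotient_of r))"
  using quotient_of_div[of r] by (cases "quotient_of r") simp

theorem corollary2p16:
  "\<exists>(prog :: com) (p :: nat poly).
     \<forall>(n :: nat) (E :: nat set set) (c :: nat \<Rightarrow> rat) (d :: nat set \<Rightarrow> rat).
       simple_graph {..<n} E \<longrightarrow> chordal {..<n} E \<longrightarrow>
       (\<exists>t s. exec prog (initial_memory (encode_instance n E c d)) t s \<and>
              t \<le> poly p (input_size (encode_instance n E c d)) \<and>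
              (n > 0 \<longrightarrow> max_weight_induced_path {..<n} E c d (output_set n s)))"
\<comment> \<open>With \<open>L\<close> the input size, \<open>[:1, 1:]\<close> is the bound
  \<open>L + 1\<close> on the rounds of a loop, one of which makes \<open>n + 1 \<le> L + 1\<close>
  rounds. The factor \<open>[:2, 3, 1, 1:]\<close> is \<open>L * (L * (L + 1) + 3) + 2\<close>,
  which is \<open>max_len\<close> with \<open>n\<close> replaced by \<open>L\<close>.\<close>
proof (rule exI[of _ path_prog],
    rule exI[of _ "pcompose (cost_poly path_prog) [:1, 1:] * [:2, 3, 1, 1:]"],
    intro allI impI)
  fix n :: nat and E :: "nat set set" and c :: "nat \<Rightarrow> rat" and d :: "nat set \<Rightarrow> rat"
  assume G: "simple_graph {..<n} E" "chordal {..<n} E"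
  define xs where "xs = encode_instance n E c d"
  define L where "L = input_size xs"
  interpret encoded_graph n E "initial_memory xs 0"
    "\<lambda>v. fst (quotient_of (c v))" "\<lambda>v. snd (quotient_of (c v))"
    "\<lambda>u v. fst (quotient_of (edge_weight E d u v))"
    "\<lambda>u v. if u < n then snd (quotient_of (edge_weight E d u v)) else 0" L
    unfolding xs_def L_def by (rule encoded_graph_encode_instance[OF G(1)])
  have n: "n \<le> L"
    using length_le_input_size[of xs] by (simp add: L_def xs_def length_encode_instance)
  have "edge_weight E d u v = of_int (fst (quotient_of (edge_weight E d u v))) /
      of_int (if u < n then snd (quotient_of (edge_weight E d u v)) else 0)"
    if "u \<le> n" "v < n" for u v
  proof (cases "u < n")
    case True
    then show ?thesis by (simp flip: rat_eq_quotient_of)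
  next
    case False
    then have "edge_weight E d u v = 0"
      using G(1) that by (auto simp: edge_weight_def simple_graph_def)
    then show ?thesis by simp
  qed
  then have "wp (L + 1) max_len path_prog
      (\<lambda>s'. 0 < n \<longrightarrow> max_weight_induced_path {..<n} E c d (output_set n s')) (initial_memory xs)"
    using n rat_eq_quotient_of by (intro wp_path_prog[OF _ _ _ _ G]) (auto simp: initial_memory_def)
  moreover have "bounded_memory max_len (initial_memory xs)"
    unfolding bounded_memory_def
  proof (intro allI)
    fix b a
    have "\<bar>initial_memory xs b a\<bar> \<le> Z ^ 1"
      using abs_initial_memory_less[of xs b a] by (simp add: L_def)
    then show "len (initial_memory xs b a) \<le> max_len" by (rule len_le_max_len') simp
  qed
  ultimately obtain t s where run: "exec path_prog (initial_memory xs) t s"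
    "0 < n \<Longrightarrow> max_weight_induced_path {..<n} E c d (output_set n s)"
    and t: "t \<le> poly (cost_poly path_prog) (L + 1) * max_len"
    unfolding wp_def by blast
  have "n * (n + 1) \<le> L * (L + 1)" using n by (intro mult_mono) auto
  then have "max_len \<le> L * (L * (L + 1) + 3) + 2"
    unfolding max_len_def by (intro add_right_mono mult_left_mono) auto
  also have "\<dots> = poly [:2, 3, 1, 1:] L" by (simp add: algebra_simps)
  finally have "poly (cost_poly path_prog) (L + 1) * max_len \<le>
      poly (pcompose (cost_poly path_prog) [:1, 1:] * [:2, 3, 1, 1:]) L"
    unfolding poly_mult poly_pcompose by (intro mult_mono) simp_all
  with t have "t \<le> poly (pcompose (cost_poly path_prog) [:1, 1:] * [:2, 3, 1, 1:]) L"
    by (rule le_trans)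
  then show "\<exists>t s. exec path_prog (initial_memory (encode_instance n E c d)) t s \<and>
      t \<le> poly (pcompose (cost_poly path_prog) [:1, 1:] * [:2, 3, 1, 1:])
        (input_size (encode_instance n E c d)) \<and>
      (0 < n \<longrightarrow> max_weight_induced_path {..<n} E c d (output_set n s))"
    using run unfolding L_def xs_def by blast
qed

end
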